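(* Let $a,c$ be coprime integers with $c>0$ and let $\tau$ be the unique zero of $E_2$ lying inside the Ford circle at $\frac{a}{c}$ (the circle with center $\frac{a}{c}+\frac{1}{2c^2}i$ and radius $\frac{1}{2c^2}$). Write $\tau=\gamma z$ with $\gamma=\begin{pmatrix}a&b\\c&d\end{pmatrix}\in SL_2(\mathbb{Z})$ and $z\in\mathcal{F}$. Then $$0.00027<\left|z-\left(-\frac{d}{c}+\frac{6}{\pi}i\right)\right|<0.00029.$$
   Context: $E_2(\tau)=1-24\sum_{n\ge1}\frac{nq^n}{1-q^n}$, $q=e^{2\pi i\tau}$, on the upper half plane $\mathbb{H}$. $SL_2(\mathbb{Z})$ acts on $\mathbb{H}$ by Möbius transformations $\gamma z=\frac{az+b}{cz+d}$. The strict fundamental domain is $\mathcal{F}=\{z\in\mathbb{H}: |z|>1,\ |\mathrm{Re}\,z|<\tfrac12\}\cup\{z\in\mathbb{H}: |z|\ge1,\ -\tfrac12\le\mathrm{Re}\,z\le0\}$. *)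

theory Defs
  imports "HOL-Analysis.Analysis"
begin

definition upper_half_plane :: "complex set" where
  "upper_half_plane = {z. Im z > 0}"

definition E2 :: "complex \<Rightarrow> complex" where
  "E2 \<tau> = (let q = exp (2 * of_real pi * \<i> * \<tau>) in
     1 - 24 * (\<Sum>n. of_nat (Suc n) * q ^ Suc n / (1 - q ^ Suc n)))"

definition SL2Z :: "(int ^ 2 ^ 2) set" where
  "SL2Z = {\<gamma>. det \<gamma> = 1}"

abbreviation mat22 :: "int \<Rightarrow> int \<Rightarrow> int \<Rightarrow> int \<Rightarrow> int ^ 2 ^ 2" where
  "mat22 a b c d \<equiv> vector [vector [a, b], vector [c, d]]"

definition moebius_act :: "int ^ 2 ^ 2 \<Rightarrow> complex \<Rightarrow> complex" where
  "moebius_act \<gamma> z = (of_int (\<gamma> $ 1 $ 1) * z + of_int (\<gamma> $ 1 $ 2)) /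
                       (of_int (\<gamma> $ 2 $ 1) * z + of_int (\<gamma> $ 2 $ 2))"

definition fund_dom :: "complex set" where
  "fund_dom =
     {z \<in> upper_half_plane. norm z > 1 \<and> \<bar>Re z\<bar> < 1 / 2} \<union>
     {z \<in> upper_half_plane. norm z \<ge> 1 \<and> - 1 / 2 \<le> Re z \<and> Re z \<le> 0}"

text \<open>The open disc bounded by the Ford circle at \<open>a / c\<close>; for \<open>c \<noteq> 0\<close> it is
  contained in the upper half plane.\<close>

definition ford_disc :: "int \<Rightarrow> int \<Rightarrow> complex set" where
  "ford_disc a c =
     ball (Complex (of_int a / of_int c) (1 / (2 * (of_int c)\<^sup>2))) (1 / (2 * (of_int c)\<^sup>2))"

end

theory Submission
  imports Defs
begin

text \<open>
  \<^bold>\<open>Transformation law.\<close> Expanding the Lambert series gives \<open>E2 z = 1 + 6 * (\<Sum>m\<ge>1. 1 / sin\<^sup>2 (\<pi> m z))\<close>,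
  and \<open>\<pi>\<^sup>2 / sin\<^sup>2\<close> is a sum of inverse squares over the integers. Passing from \<open>z\<close> to \<open>- 1 / z\<close>
  therefore exchanges the order of summation in the conditionally convergent double series of
  \<open>1 / (m z + n)\<^sup>2 + 1 / (m z - n)\<^sup>2\<close> over \<open>m, n \<ge> 1\<close>. Comparing each summand with its integral over a unit
  cell, a mixed second difference of \<open>(Ln (x z - y) - Ln (x z + y)) / z\<close>, leaves an absolutely convergent
  error, while the differences telescope; the two orders of summation see the limits of this function
  for \<open>x \<rightarrow> \<infinity>\<close> and \<open>y \<rightarrow> \<infinity>\<close>, which differ by \<open>\<i> \<pi> / z\<close>.

  \<^bold>\<open>Zeros.\<close> The Ford disc at \<open>a / c\<close> is the image of \<open>Im z > 1\<close> under \<open>\<gamma>\<close>, and by the transformation law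
  \<open>E2 (\<gamma> z) = 0\<close> means \<open>z = - d / c + (6 \<i> / \<pi>) / E2 z\<close>. As \<open>E2\<close> is close to \<open>1\<close> for \<open>Im z \<ge> 1\<close>, the right-hand
  side is a contraction of that half plane. At the fixed point \<open>Im z\<close> is nearly \<open>6 / \<pi>\<close>, so
  \<open>\<bar>q\<bar>\<close> is nearly \<open>exp (- 12)\<close> and the distance is about \<open>144 / \<pi> * exp (- 12) = 0.00028\<dots>\<close>.
\<close>

section \<open>Double series and partial fractions\<close>

text \<open>A majorant that factors makes the family absolutely summable over all pairs, so Fubini
  for \<open>infsum\<close> applies; what remains is the passage between unordered and ordered
  sums.\<close>

lemma dominated_double_series:
  fixes h :: "nat \<Rightarrow> nat \<Rightarrow> 'a::banach" and a b :: "nat \<Rightarrow> real"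
  assumes a: "summable a" "\<And>m. a m \<ge> 0" and b: "summable b" "\<And>n. b n \<ge> 0"
    and h: "\<And>m n. norm (h m n) \<le> a m * b n"
  shows "summable (h m)" "summable (\<lambda>m. h m n)"
    "summable (\<lambda>m. \<Sum>n. h m n)" "summable (\<lambda>n. \<Sum>m. h m n)"
    "(\<Sum>m. \<Sum>n. h m n) = (\<Sum>n. \<Sum>m. h m n)"
proof -
  have n1: "summable (\<lambda>n. norm (h m n))" for m
    by (rule summable_comparison_test'[where g = "\<lambda>n. a m * b n" and N = 0])
      (use b h in \<open>auto intro: summable_mult\<close>)
  have n2: "summable (\<lambda>m. norm (h m n))" for n
    by (rule summable_comparison_test'[where g = "\<lambda>m. a m * b n" and N = 0])
      (use a h in \<open>auto intro: summable_mult2\<close>)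
  show "summable (h m)" "summable (\<lambda>m. h m n)"
    using n1 n2 by (auto intro: summable_norm_cancel)
  have "(\<lambda>(m, n). a m * b n) summable_on (UNIV \<times> UNIV)"
  proof (rule summable_on_SigmaI)
    show "((\<lambda>n. case (m, n) of (m, n) \<Rightarrow> a m * b n) has_sum a m * suminf b) UNIV" for m
    proof -
      have "(b has_sum suminf b) UNIV"
        using b by (simp add: sums_nonneg_imp_has_sum summable_sums)
      then show ?thesis by (simp add: has_sum_cmult_right)
    qed
    show "(\<lambda>m. a m * suminf b) summable_on UNIV"
      using a by (intro summable_on_cmult_left summable_nonneg_imp_summable_on) auto
  qed (use a b in auto)
  then have "(\<lambda>p. norm (case p of (m, n) \<Rightarrow> h m n)) summable_on (UNIV \<times> UNIV)"
    by (rule summable_on_comparison_test) (use h in auto)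
  then have S: "(\<lambda>(m, n). h m n) summable_on (UNIV \<times> UNIV)"
    by (rule abs_summable_summable)
  then have S': "(\<lambda>(n, m). h m n) summable_on (UNIV \<times> UNIV)"
    using summable_on_swap[of "\<lambda>(m, n). h m n" UNIV UNIV] by (simp add: case_prod_unfold)
  have i1: "(\<Sum>\<^sub>\<infinity>n. h m n) = (\<Sum>n. h m n)" for m
    using norm_summable_imp_summable_on[OF n1] has_sum_imp_sums has_sum_infsum sums_unique by blast
  have i2: "(\<Sum>\<^sub>\<infinity>m. h m n) = (\<Sum>m. h m n)" for n
    using norm_summable_imp_summable_on[OF n2] has_sum_imp_sums has_sum_infsum sums_unique by blast
  have s1: "(\<lambda>m. \<Sum>n. h m n) summable_on UNIV"
    using summable_on_Sigma_banach[OF S] by (simp add: i1)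
  have s2: "(\<lambda>n. \<Sum>m. h m n) summable_on UNIV"
    using summable_on_Sigma_banach[OF S'] by (simp add: i2)
  show "summable (\<lambda>m. \<Sum>n. h m n)" "summable (\<lambda>n. \<Sum>m. h m n)"
    using s1 s2 by (auto intro: summable_on_imp_summable)
  show "(\<Sum>m. \<Sum>n. h m n) = (\<Sum>n. \<Sum>m. h m n)"
    using infsum_swap_banach[OF S] s1 s2
    by (metis (no_types, lifting) has_sum_imp_sums has_sum_infsum i1 i2 infsum_cong sums_unique)
qed

text \<open>Differentiate both sides of Euler's reflection formula for
  \<open>Gamma z * Gamma (1 - z)\<close> and cancel the factor
  \<open>pi / sin (pi * z)\<close>.\<close>

lemma Digamma_reflection_complex:
  fixes z :: complex
  assumes z: "z \<notin> \<int>"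
  shows "Digamma z - Digamma (1 - z) = - (pi * cot (pi * z))"
proof -
  have z': "z \<notin> \<int>\<^sub>\<le>\<^sub>0" "1 - z \<notin> \<int>\<^sub>\<le>\<^sub>0"
    using z nonpos_Ints_Int[of z] nonpos_Ints_Int[of "1 - z"] Ints_diff[of 1 "1 - z"] by auto
  have s: "sin (pi * z) \<noteq> 0"
    using z by (auto simp: sin_eq_0 Ints_def)
  have "((\<lambda>z. Gamma z * Gamma (1 - z)) has_field_derivative
      Gamma z * Gamma (1 - z) * (Digamma z - Digamma (1 - z))) (at z)"
    using z' by (auto intro!: derivative_eq_intros simp: algebra_simps)
  moreover have "((\<lambda>z. Gamma z * Gamma (1 - z)) has_field_derivative
      - (pi * (pi * cos (pi * z))) / (sin (pi * z))\<^sup>2) (at z)"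
    unfolding Gamma_reflection_complex
    using s by (auto intro!: derivative_eq_intros simp: power2_eq_square)
  ultimately have "Gamma z * Gamma (1 - z) * (Digamma z - Digamma (1 - z)) =
      - (pi * (pi * cos (pi * z))) / (sin (pi * z))\<^sup>2"
    by (rule DERIV_unique)
  then have "pi / sin (pi * z) * (Digamma z - Digamma (1 - z)) =
      pi / sin (pi * z) * - (pi * cot (pi * z))"
    by (simp add: Gamma_reflection_complex cot_def power2_eq_square)
  then show ?thesis
    using s by (subst (asm) mult_left_cancel) auto
qed

text \<open>The derivative of the previous reflection formula. The trigamma series at
  \<open>z\<close> supplies the shifts \<open>z + n\<close> with n >= 0, the one at
  \<open>1 - z\<close> the shifts \<open>z - n\<close> with n >= 1; the unpaired term
  \<open>1 / z^2\<close> goes to the right-hand side.\<close>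

lemma inverse_sin_squared_sums:
  fixes z :: complex
  assumes z: "z \<notin> \<int>"
  shows "(\<lambda>n. 1 / (z + of_nat (Suc n))\<^sup>2 + 1 / (z - of_nat (Suc n))\<^sup>2) sums
           ((pi / sin (pi * z))\<^sup>2 - 1 / z\<^sup>2)"
proof -
  have z': "z \<notin> \<int>\<^sub>\<le>\<^sub>0" "1 - z \<notin> \<int>\<^sub>\<le>\<^sub>0"
    using z nonpos_Ints_Int[of z] nonpos_Ints_Int[of "1 - z"] Ints_diff[of 1 "1 - z"] by auto
  have z0: "z \<noteq> 0" "1 - z \<noteq> 0" using z by auto
  have s: "sin (pi * z) \<noteq> 0"
    using z by (auto simp: sin_eq_0 Ints_def)
  have alg: "- (p * (((- s * p) * s - c * (c * p)) / (s * s))) = p\<^sup>2 * (s\<^sup>2 + c\<^sup>2) / s\<^sup>2"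
    if "s \<noteq> 0" for p s c :: complex
    using that by (simp add: field_simps power2_eq_square)
  have "((\<lambda>z. Digamma z - Digamma (1 - z)) has_field_derivative
      Polygamma 1 z + Polygamma 1 (1 - z)) (at z)"
    using z' by (auto intro!: derivative_eq_intros)
  moreover have "((\<lambda>z. Digamma z - Digamma (1 - z)) has_field_derivative
      (pi / sin (pi * z))\<^sup>2) (at z)"
  proof (rule has_field_derivative_transform_within_open[where S = "- \<int>"])
    show "((\<lambda>z::complex. - (pi * cot (pi * z))) has_field_derivative (pi / sin (pi * z))\<^sup>2) (at z)"
    proof -
      have "((\<lambda>z::complex. - (pi * cot (pi * z))) has_field_derivative
          - (pi * (((- sin (pi * z) * pi) * sin (pi * z) - cos (pi * z) * (cos (pi * z) * pi)) /
            (sin (pi * z) * sin (pi * z))))) (at z)"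
        unfolding cot_def using s by (auto intro!: derivative_eq_intros simp: algebra_simps)
      also have "- (pi * (((- sin (pi * z) * pi) * sin (pi * z) - cos (pi * z) * (cos (pi * z) * pi)) /
            (sin (pi * z) * sin (pi * z)))) =
          of_real pi ^ 2 * ((sin (pi * z))\<^sup>2 + (cos (pi * z))\<^sup>2) / (sin (pi * z))\<^sup>2"
        by (rule alg[OF s])
      finally show ?thesis by (simp add: power_divide)
    qed
    show "open (- \<int> :: complex set)" by (simp add: open_Compl)
  qed (use z in \<open>auto simp: Digamma_reflection_complex\<close>)
  ultimately have P: "Polygamma 1 z + Polygamma 1 (1 - z) = (pi / sin (pi * z))\<^sup>2"
    by (rule DERIV_unique)
  have S: "(\<lambda>k. inverse ((w + of_nat k)\<^sup>2)) sums Polygamma 1 w" if "w \<noteq> 0" for w :: complex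
    using Polygamma_LIMSEQ[of w 1] that by (simp add: numeral_2_eq_2)
  have "(\<lambda>k. inverse ((z + of_nat (Suc k))\<^sup>2)) sums (Polygamma 1 z - 1 / z\<^sup>2)"
    using sums_Suc_iff[of "\<lambda>k. inverse ((z + of_nat k)\<^sup>2)"] S[of z] z0 by (simp add: divide_inverse)
  then have "(\<lambda>k. inverse ((z + of_nat (Suc k))\<^sup>2) + inverse ((1 - z + of_nat k)\<^sup>2)) sums
      (Polygamma 1 z - 1 / z\<^sup>2 + Polygamma 1 (1 - z))"
    using S[of "1 - z"] z0 by (intro sums_add)
  also have "(\<lambda>k. inverse ((z + of_nat (Suc k))\<^sup>2) + inverse ((1 - z + of_nat k)\<^sup>2)) =
      (\<lambda>n. 1 / (z + of_nat (Suc n))\<^sup>2 + 1 / (z - of_nat (Suc n))\<^sup>2)"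
  proof
    fix k
    have "(1 - z + of_nat k)\<^sup>2 = (z - of_nat (Suc k))\<^sup>2"
      by (simp add: power2_eq_square algebra_simps)
    then show "inverse ((z + of_nat (Suc k))\<^sup>2) + inverse ((1 - z + of_nat k)\<^sup>2) =
      1 / (z + of_nat (Suc k))\<^sup>2 + 1 / (z - of_nat (Suc k))\<^sup>2"
      by (simp only: divide_inverse mult_1)
  qed
  finally show ?thesis using P by (simp add: algebra_simps)
qed

section \<open>The Lambert series as a series of inverse squared sines\<close>

definition lambert :: "complex \<Rightarrow> complex" where
  "lambert q = (\<Sum>n. of_nat (Suc n) * q ^ Suc n / (1 - q ^ Suc n))"

lemma E2_lambert: "E2 z = 1 - 24 * lambert (exp (2 * of_real pi * \<i> * z))"
  by (simp add: E2_def lambert_def Let_def)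

text \<open>Both sides are iterated sums of \<open>n * q^(n * m)\<close> over n, m >= 1: summing
  over m first gives the Lambert series, summing over n first gives the derivative of a geometric
  series.\<close>

lemma lambert_series_rearrange:
  fixes q :: complex
  assumes q: "norm q < 1"
  shows "(\<lambda>m. q ^ Suc m / (1 - q ^ Suc m)\<^sup>2) sums lambert q"
proof -
  define h where "h m n = of_nat (Suc n) * q ^ (Suc n * Suc m)" for m n
  have pq: "norm (q ^ Suc k) < 1" for k
    using q by (simp add: norm_power power_less_one_iff flip: power_Suc)
  \<comment> \<open>Since (n + 1)(m + 1) >= m + n, the terms have a majorant that factors.\<close>
  have "norm (h m n) \<le> norm q ^ m * (of_nat (Suc n) * norm q ^ n)" for m n
  proof -
    have "norm q ^ (Suc n * Suc m) \<le> norm q ^ (m + n)"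
      using q by (intro power_decreasing) auto
    then have "real (Suc n) * norm q ^ (Suc n * Suc m) \<le> real (Suc n) * norm q ^ (m + n)"
      by (rule mult_left_mono) simp
    then show ?thesis
      by (simp only: h_def norm_mult norm_power norm_of_nat power_add mult_ac)
  qed
  note D = dominated_double_series[where h = h, OF summable_geometric _
      sums_summable[OF geometric_deriv_sums[of "norm q"]] _ this]
  have "(h m) sums (q ^ Suc m / (1 - q ^ Suc m)\<^sup>2)" for m
  proof -
    have "h m = (\<lambda>n. q ^ Suc m * (of_nat (Suc n) * (q ^ Suc m) ^ n))"
    proof
      fix n
      have "q ^ (Suc n * Suc m) = (q ^ Suc m) ^ Suc n"
        by (subst mult.commute) (rule power_mult)
      then show "h m n = q ^ Suc m * (of_nat (Suc n) * (q ^ Suc m) ^ n)"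
        by (simp add: h_def del: power_Suc of_nat_Suc) (simp add: mult_ac)
    qed
    then show ?thesis
      using sums_mult[OF geometric_deriv_sums[OF pq[of m]], of "q ^ Suc m"] by simp
  qed
  then have 1: "(\<Sum>n. h m n) = q ^ Suc m / (1 - q ^ Suc m)\<^sup>2" for m
    by (rule sums_unique[symmetric])
  have "(\<lambda>m. h m n) sums (of_nat (Suc n) * q ^ Suc n / (1 - q ^ Suc n))" for n
  proof -
    have "(\<lambda>m. h m n) = (\<lambda>m. of_nat (Suc n) * q ^ Suc n * (q ^ Suc n) ^ m)"
    proof
      fix m
      have "q ^ (Suc n * Suc m) = (q ^ Suc n) ^ Suc m"
        by (rule power_mult)
      then show "h m n = of_nat (Suc n) * q ^ Suc n * (q ^ Suc n) ^ m"
        by (simp add: h_def del: power_Suc of_nat_Suc) (simp add: mult_ac)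
    qed
    then show ?thesis
      using sums_mult[OF geometric_sums[OF pq[of n]], of "of_nat (Suc n) * q ^ Suc n"] by simp
  qed
  then have 2: "(\<Sum>m. h m n) = of_nat (Suc n) * q ^ Suc n / (1 - q ^ Suc n)" for n
    by (rule sums_unique[symmetric])
  show ?thesis
    using D(3,5) q unfolding 1 2 by (simp add: sums_iff lambert_def)
qed

text \<open>With e = exp(i w), \<open>sin w\<close> is \<open>(1 - e^2) * i / (2 e)\<close>;
  squaring gives the claim. It is applied with \<open>w = pi * m * z\<close>.\<close>

lemma exp_div_square_eq_inverse_sin_squared:
  fixes w :: complex
  assumes "sin w \<noteq> 0"
  shows "exp (2 * \<i> * w) / (1 - exp (2 * \<i> * w))\<^sup>2 = - 1 / (4 * (sin w)\<^sup>2)"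
proof -
  define e where "e = exp (\<i> * w)"
  have e: "e \<noteq> 0" by (simp add: e_def)
  have e2: "exp (2 * \<i> * w) = e\<^sup>2"
    by (simp add: e_def mult.assoc flip: exp_double)
  have s: "sin w = (e - 1 / e) / (2 * \<i>)"
    by (simp only: e_def sin_exp_eq exp_minus inverse_eq_divide)
  have s': "sin w = (1 - e\<^sup>2) * (\<i> / (2 * e))"
    using e unfolding s by (simp add: divide_simps power2_eq_square) (simp add: algebra_simps)
  then have nz: "1 - e\<^sup>2 \<noteq> 0" using assms by auto
  have "(sin w)\<^sup>2 = (1 - e\<^sup>2)\<^sup>2 * (- 1 / (4 * e\<^sup>2))"
    unfolding s' by (simp add: power_mult_distrib power_divide)
  then show ?thesis
    unfolding e2 using e nz assms by (simp add: divide_simps mult_ac)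
qed

lemma sin_pi_of_nat_mult_nonzero:
  fixes z :: complex
  assumes "Im z > 0"
  shows "of_nat (Suc m) * z \<notin> \<int>" "sin (pi * (of_nat (Suc m) * z)) \<noteq> 0"
proof -
  have "Im (of_nat (Suc m) * z) \<noteq> 0" using assms by (simp del: of_nat_Suc)
  then show 1: "of_nat (Suc m) * z \<notin> \<int>" by (metis Ints_cases complex_Im_of_int)
  show "sin (pi * (of_nat (Suc m) * z)) \<noteq> 0"
    using 1 by (auto simp: sin_eq_0 Ints_def simp del: of_nat_Suc)
qed

text \<open>The factor -1/4 from the sine identity turns the coefficient -24 of the Lambert series
  into 6.\<close>

lemma E2_sin_series:
  fixes z :: complex
  assumes z: "Im z > 0"
  shows "(\<lambda>m. (pi / sin (pi * (of_nat (Suc m) * z)))\<^sup>2) sums (pi\<^sup>2 / 6 * (E2 z - 1))"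
proof -
  define q where "q = exp (2 * of_real pi * \<i> * z)"
  have "norm q < 1" using z by (simp add: q_def norm_exp_eq_Re)
  note L = lambert_series_rearrange[OF this]
  have E: "E2 z = 1 - 24 * lambert q"
    by (simp add: E2_lambert q_def)
  have "q ^ Suc m / (1 - q ^ Suc m)\<^sup>2 =
      - 1 / (4 * pi\<^sup>2) * (pi / sin (pi * (of_nat (Suc m) * z)))\<^sup>2" for m
  proof -
    have "q ^ Suc m = exp (2 * \<i> * (pi * (of_nat (Suc m) * z)))"
      unfolding q_def exp_of_nat_mult[symmetric] by (simp only: mult_ac)
    then show ?thesis
      using exp_div_square_eq_inverse_sin_squared[OF sin_pi_of_nat_mult_nonzero(2)[OF z, of m]]
      by (simp add: power_divide del: of_nat_Suc power_Suc)
  qed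
  from L[unfolded this] have "(\<lambda>m. of_real (- 4 * pi\<^sup>2) * (of_real (- 1 / (4 * pi\<^sup>2)) *
        (pi / sin (pi * (of_nat (Suc m) * z)))\<^sup>2)) sums
      (of_real (- 4 * pi\<^sup>2) * lambert q)"
    by (rule sums_mult)
  moreover have "of_real (- 4 * pi\<^sup>2) * of_real (- 1 / (4 * pi\<^sup>2)) = (1 :: complex)"
    unfolding of_real_mult[symmetric] by simp
  moreover have "of_real (- 4 * pi\<^sup>2) * lambert q =
      pi\<^sup>2 / 6 * (E2 z - 1)"
    unfolding E by simp
  ultimately show ?thesis
    by (simp only: mult.assoc[symmetric] mult_1_left)
qed

section \<open>Exchanging the order of summation\<close>

text \<open>The imaginary part controls \<open>x\<close>, and the triangle inequality then controls
  \<open>y\<close>. This provides the decay in \<open>x + y\<close> of the lattice terms.\<close>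

lemma norm_linear_form_ge:
  fixes z :: complex and x y :: real
  assumes z: "Im z > 0" and x: "x \<ge> 0"
  shows "x + \<bar>y\<bar> \<le> (1 + (1 + norm z) / Im z) * norm (of_real x * z + of_real y)"
proof -
  let ?w = "of_real x * z + of_real y"
  have "x * Im z \<le> norm ?w"
    using abs_Im_le_cmod[of ?w] z x by (simp add: abs_mult)
  then have x': "x \<le> norm ?w / Im z" using z by (simp add: field_simps)
  have "\<bar>y\<bar> = norm (?w - of_real x * z)" by simp
  also have "\<dots> \<le> norm ?w + x * norm z"
    using norm_triangle_ineq4[of ?w "of_real x * z"] x by (simp add: norm_mult)
  also have "\<dots> \<le> norm ?w + norm ?w / Im z * norm z"
    using x' by (intro add_left_mono mult_right_mono) auto
  finally show ?thesis using x' by (simp add: algebra_simps add_divide_distrib)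
qed

text \<open>The mixed partial derivative of \<open>Ln (x z + s y)\<close> is
  \<open>- s z / (x z + s y)^2\<close>, since s^2 = 1 leaves a single sign. The difference over a
  unit cell therefore agrees with its value at the corner up to an error one order smaller.\<close>

lemma Ln_mixed_difference_bound:
  fixes z :: complex
  assumes z: "Im z > 0"
  obtains C where "C \<ge> 0"
    "\<And>(x::real) (y::real) (s::real). x \<ge> 1 \<Longrightarrow> y \<ge> 1 \<Longrightarrow> s\<^sup>2 = 1 \<Longrightarrow>
       norm (Ln ((x + 1) * z + s * (y + 1)) - Ln (x * z + s * (y + 1)) - Ln ((x + 1) * z + s * y)
         + Ln (x * z + s * y) + s * z / (x * z + s * y)\<^sup>2) \<le> C / (x + y) ^ 3"
proof -
  define K where "K = 1 + (1 + norm z) / Im z"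
  have K: "K \<ge> 1" using z by (simp add: K_def)
  define C where "C = norm z * ((2 + norm z) + (1 + norm z) * K) * K ^ 3"
  show ?thesis
  proof (rule that[of C])
    show "C \<ge> 0" using K by (simp add: C_def)
    fix x y s :: real
    assume x: "x \<ge> 1" and y: "y \<ge> 1" and s: "s\<^sup>2 = 1"
    have s1: "\<bar>s\<bar> = 1" using s by (metis power2_eq_1_iff abs_1 abs_minus_cancel)
    have ss: "complex_of_real s * of_real s = 1"
      using s by (metis of_real_1 of_real_mult power2_eq_square)
    define A where "A = (x + y) / K"
    have A: "A > 0" using K x y by (simp add: A_def)
    have AK: "1 \<le> A * K" using K x y by (simp add: A_def)
    have low: "A \<le> norm (of_real u * z + of_real (s * v))" if "u \<ge> x" "v \<ge> y" for u v
    proof -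
      have "x + y \<le> u + \<bar>s * v\<bar>" using that s1 y by (simp add: abs_mult)
      also have "\<dots> \<le> K * norm (of_real u * z + of_real (s * v))"
        unfolding K_def using that x by (intro norm_linear_form_ge z) auto
      finally show ?thesis using K by (simp add: A_def field_simps)
    qed
    define w where "w = x * z + s * y"
    \<comment> \<open>The difference in \<open>x\<close> is taken exactly and \<open>t\<close> runs
      through the step in \<open>y\<close>, so a mean value bound in the one variable
      \<open>t\<close> suffices.\<close>
    define \<phi> where "\<phi> t = Ln (w + z + s * t) - Ln (w + s * t) + t * (s * z / w\<^sup>2)" for t :: complex
    have "norm (\<phi> 1 - \<phi> 0) \<le> C / (x + y) ^ 3 * norm (1 - 0 :: complex)"
    proof (rule field_differentiable_bound[of "closed_segment 0 1"])
      fix t :: complex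
      assume "t \<in> closed_segment 0 1"
      then obtain r where r: "0 \<le> r" "r \<le> 1" and t: "t = of_real r"
        by (auto simp: closed_segment_def scaleR_conv_of_real)
      have Im: "Im (w + z + s * t) > 0" "Im (w + s * t) > 0"
        using z x by (auto simp: w_def t add_pos_pos)
      then have nz: "w + z + s * t \<noteq> 0" "w + s * t \<noteq> 0" "w \<noteq> 0"
        using z x by (auto simp: w_def complex_eq_iff)
      have nn: "w + z + s * t \<notin> \<real>\<^sub>\<le>\<^sub>0" "w + s * t \<notin> \<real>\<^sub>\<le>\<^sub>0"
        using Im by (auto simp: complex_nonpos_Reals_iff)
      show "(\<phi> has_field_derivative
          (s / (w + z + s * t) - s / (w + s * t) + s * z / w\<^sup>2)) (at t within closed_segment 0 1)"
        unfolding \<phi>_def using nn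
        by (auto intro!: derivative_eq_intros simp: divide_inverse)
      have l: "A \<le> norm w" "A \<le> norm (w + s * t)" "A \<le> norm (w + z + s * t)"
        using low[of x y] low[of x "y + r"] low[of "x + 1" "y + r"] r
        by (auto simp: w_def t algebra_simps)
      \<comment> \<open>Over a common denominator of degree four in \<open>w\<close>, the quadratic
        terms of the numerator cancel; it has degree one, which leaves cubic decay.\<close>
      have "s / (w + z + s * t) - s / (w + s * t) + s * z / w\<^sup>2 =
          s * z * ((2 * s * t + z) * w + (t * t + s * t * z)) / (w\<^sup>2 * (w + s * t) * (w + z + s * t))"
      proof -
        have 1: "(w + z + s * t) * (w + s * t) - w\<^sup>2 = (2 * s * t + z) * w + (t * t + s * t * z)"
          using ss by (simp add: power2_eq_square algebra_simps)
        have 2: "s / (w + z + s * t) - s / (w + s * t) = - (s * z) / ((w + z + s * t) * (w + s * t))"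
          using nz by (simp add: divide_simps) (simp add: algebra_simps)
        have 3: "- c / p + c / w\<^sup>2 = c * (p - w\<^sup>2) / (w\<^sup>2 * p)" if "p \<noteq> 0" for c p :: complex
          using nz that by (simp add: divide_simps) (simp add: algebra_simps)
        have "w\<^sup>2 * ((w + z + s * t) * (w + s * t)) = w\<^sup>2 * (w + s * t) * (w + z + s * t)"
          by (simp only: mult_ac)
        then show ?thesis
          unfolding 2 using 3[of "(w + z + s * t) * (w + s * t)" "s * z"] nz
          unfolding 1 by simp
      qed
      also have "norm \<dots> = norm z * norm ((2 * s * t + z) * w + (t * t + s * t * z)) /
          (norm w ^ 2 * norm (w + s * t) * norm (w + z + s * t))"
        using s1 by (simp add: norm_mult norm_divide norm_power)
      also have "\<dots> \<le> norm z * ((2 + norm z) * norm w + (1 + norm z)) /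
          (norm w ^ 2 * A * A)"
      proof -
        have "norm ((2 * s * t + z) * w + (t * t + s * t * z)) \<le>
            norm (2 * s * t + z) * norm w + norm (t * t + s * t * z)"
          by (metis norm_mult norm_triangle_ineq)
        also have "norm (2 * s * t + z) \<le> 2 + norm z"
          using norm_triangle_ineq[of "2 * s * t" z] r s1 by (simp add: norm_mult t)
        also have "norm (t * t + s * t * z) \<le> norm (t * t) + norm (s * t * z)"
          by (rule norm_triangle_ineq)
        also have "\<dots> \<le> 1 + norm z"
          using r s1 by (auto simp: norm_mult t intro!: add_mono mult_le_one mult_left_le_one_le)
        finally have "norm ((2 * s * t + z) * w + (t * t + s * t * z)) \<le>
            (2 + norm z) * norm w + (1 + norm z)"
          by (simp add: mult_right_mono)
        then show ?thesis
          using l A by (intro frac_le mult_mono mult_pos_pos mult_nonneg_nonneg) auto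
      qed
      also have "\<dots> = norm z * ((2 + norm z) / norm w + (1 + norm z) / (norm w * norm w)) / (A * A)"
        using nz A by (simp add: field_simps power2_eq_square)
      \<comment> \<open>One factor \<open>norm w\<close> is bounded below by the constant
        \<open>1 / K\<close> only, so that both summands become multiples of
        \<open>1 / A\<close>.\<close>
      also have "\<dots> \<le> norm z * ((2 + norm z) / A + (1 + norm z) / (A * (1 / K))) / (A * A)"
      proof -
        have "1 / K \<le> A" using AK K by (simp add: field_simps)
        then have "1 / K \<le> norm w" using l by simp
        then show ?thesis using l A K
          by (intro divide_right_mono mult_left_mono add_mono frac_le mult_mono) auto
      qed
      also have "\<dots> = C / (x + y) ^ 3"
        using A K x y by (simp add: C_def A_def divide_simps power3_eq_cube) (simp add: algebra_simps)
      finally show "norm (s / (w + z + s * t) - s / (w + s * t) + s * z / w\<^sup>2) \<le> C / (x + y) ^ 3" .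
    qed auto
    moreover have "\<phi> 1 - \<phi> 0 = Ln ((x + 1) * z + s * (y + 1)) - Ln (x * z + s * (y + 1))
        - Ln ((x + 1) * z + s * y) + Ln (x * z + s * y) + s * z / (x * z + s * y)\<^sup>2"
      by (simp add: \<phi>_def w_def algebra_simps)
    ultimately show "norm (Ln ((x + 1) * z + s * (y + 1)) - Ln (x * z + s * (y + 1))
        - Ln ((x + 1) * z + s * y) + Ln (x * z + s * y) + s * z / (x * z + s * y)\<^sup>2)
        \<le> C / (x + y) ^ 3"
      by simp
  qed
qed

text \<open>An antiderivative in both \<open>x\<close> and \<open>y\<close> of
  \<open>1 / (x z + y)^2 + 1 / (x z - y)^2\<close>.\<close>

definition Ln_quotient :: "complex \<Rightarrow> real \<Rightarrow> real \<Rightarrow> complex" where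
  "Ln_quotient z x y = (Ln (x * z - y) - Ln (x * z + y)) / z"

text \<open>Pulling the positive factor \<open>x\<close> out of both logarithms cancels
  \<open>ln x\<close> and leaves two arguments that tend to \<open>z\<close>.\<close>

lemma Ln_quotient_tendsto_0:
  assumes z: "Im z > 0" and y: "y > 0"
  shows "((\<lambda>x. Ln_quotient z x y) \<longlongrightarrow> 0) at_top"
proof -
  have z0: "z \<noteq> 0" "z \<notin> \<real>\<^sub>\<le>\<^sub>0" using z by (auto simp: complex_nonpos_Reals_iff)
  have "((\<lambda>x. (Ln (z - of_real (y / x)) - Ln (z + of_real (y / x))) / z) \<longlongrightarrow>
      (Ln (z - of_real 0) - Ln (z + of_real 0)) / z) at_top"
    using z0 by (intro tendsto_intros tendsto_divide_0[OF tendsto_const] filterlim_at_top_imp_at_infinity filterlim_ident) auto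
  moreover have "eventually (\<lambda>x. (Ln (z - of_real (y / x)) - Ln (z + of_real (y / x))) / z =
      Ln_quotient z x y) at_top"
    using eventually_gt_at_top[of 0]
  proof eventually_elim
    case (elim x)
    have nz: "z - of_real (y / x) \<noteq> 0" "z + of_real (y / x) \<noteq> 0"
      using z by (auto simp: complex_eq_iff)
    have "x * z - y = of_real x * (z - of_real (y / x))" "x * z + y = of_real x * (z + of_real (y / x))"
      using elim by (simp_all add: field_simps)
    then show ?case
      using Ln_times_of_real[OF elim nz(1)] Ln_times_of_real[OF elim nz(2)]
      by (simp add: Ln_quotient_def)
  qed
  ultimately show ?thesis by (simp add: tendsto_cong)
qed

text \<open>Here \<open>y\<close> is pulled out. The point \<open>x z - y\<close> approaches the
  direction of the negative axis from above, which contributes the argument pi.\<close>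

lemma Ln_quotient_tendsto_pi:
  assumes z: "Im z > 0" and x: "x > 0"
  shows "((\<lambda>y. Ln_quotient z x y) \<longlongrightarrow> \<i> * pi / z) at_top"
proof -
  have z0: "z \<noteq> 0" using z by auto
  have "((\<lambda>y. (\<i> * pi + Ln (1 - of_real (x / y) * z) - Ln (1 + of_real (x / y) * z)) / z) \<longlongrightarrow>
      (\<i> * pi + Ln (1 - of_real 0 * z) - Ln (1 + of_real 0 * z)) / z) at_top"
    using z0 by (intro tendsto_intros tendsto_divide_0[OF tendsto_const] filterlim_at_top_imp_at_infinity filterlim_ident) auto
  moreover have "eventually (\<lambda>y. (\<i> * pi + Ln (1 - of_real (x / y) * z) - Ln (1 + of_real (x / y) * z)) / z =
      Ln_quotient z x y) at_top"
    using eventually_gt_at_top[of 0]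
  proof eventually_elim
    case (elim y)
    have Im: "Im (1 - of_real (x / y) * z) < 0" "Im (1 + of_real (x / y) * z) > 0"
      using z x elim by auto
    then have nz: "1 - of_real (x / y) * z \<noteq> 0" "1 + of_real (x / y) * z \<noteq> 0"
      by (metis less_irrefl zero_complex.simps(2))+
    have e: "x * z - y = - (of_real y * (1 - of_real (x / y) * z))"
        "x * z + y = of_real y * (1 + of_real (x / y) * z)"
      using elim by (simp_all add: field_simps)
    \<comment> \<open>The sign decides the branch: negating a point below the real axis adds
      \<open>+ i pi\<close> to the principal logarithm.\<close>
    have "Im (of_real y * (1 - of_real (x / y) * z)) < 0"
      using z x elim by simp
    moreover have "of_real y * (1 - of_real (x / y) * z) \<noteq> 0" using nz elim by simp
    ultimately have "Ln (- (of_real y * (1 - of_real (x / y) * z))) =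
        Ln (of_real y * (1 - of_real (x / y) * z)) + \<i> * pi"
      by (subst Ln_minus) auto
    then show ?case
      using Ln_times_of_real[OF elim nz(1)] Ln_times_of_real[OF elim nz(2)]
      by (simp add: Ln_quotient_def e)
  qed
  ultimately show ?thesis by (simp add: tendsto_cong)
qed

lemma summable_Suc_powr: "summable (\<lambda>n. real (Suc n) powr (- 3 / 2))"
  using summable_real_powr_iff[of "- 3 / 2"] by (subst summable_Suc_iff) simp

text \<open>Split \<open>f = h + G\<close>. The part \<open>h\<close> is dominated and its iterated
  sums agree; \<open>G\<close> telescopes and carries the whole discrepancy
  \<open>i pi / z\<close>.\<close>

lemma lattice_sum_swap:
  fixes z :: complex
  assumes z: "Im z > 0"
  defines "f \<equiv> \<lambda>m n. 1 / (of_nat (Suc m) * z + of_nat (Suc n))\<^sup>2 +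
                       1 / (of_nat (Suc m) * z - of_nat (Suc n))\<^sup>2"
  obtains s where "(\<lambda>m. \<Sum>n. f m n) sums s" "(\<lambda>n. \<Sum>m. f m n) sums (s - \<i> * pi / z)"
proof -
  have z0: "z \<noteq> 0" using z by auto
  define F where "F m n = Ln_quotient z (real (Suc m)) (real (Suc n))" for m n
  define G where "G m n = F (Suc m) (Suc n) - F m (Suc n) - F (Suc m) n + F m n" for m n
  have S: "filterlim (\<lambda>n. real (Suc n)) at_top sequentially"
    by (rule filterlim_compose[OF filterlim_real_sequentially filterlim_Suc])
  have F1: "(\<lambda>m. F m n) \<longlonglongrightarrow> 0" for n
    unfolding F_def by (rule filterlim_compose[OF Ln_quotient_tendsto_0[OF z] S]) simp
  have F2: "(\<lambda>n. F m n) \<longlonglongrightarrow> \<i> * pi / z" for m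
    unfolding F_def by (rule filterlim_compose[OF Ln_quotient_tendsto_pi[OF z] S]) simp
  \<comment> \<open>The limits at infinity do not depend on the other index and cancel in the inner
    sums. The outer sums telescope again, and there the two different limits of \<open>F\<close>
    remain.\<close>
  have G1: "(\<lambda>n. G m n) sums (F m 0 - F (Suc m) 0)" for m
    using telescope_sums[OF tendsto_diff[OF F2[of "Suc m"] F2[of m]]]
    by (simp add: G_def algebra_simps)
  have G2: "(\<lambda>m. G m n) sums (F 0 n - F 0 (Suc n))" for n
    using telescope_sums[OF tendsto_diff[OF F1[of "Suc n"] F1[of n]]]
    by (simp add: G_def algebra_simps)
  have G12: "(\<lambda>m. F m 0 - F (Suc m) 0) sums F 0 0"
    using telescope_sums'[OF F1[of 0]] by simp
  have G21: "(\<lambda>n. F 0 n - F 0 (Suc n)) sums (F 0 0 - \<i> * pi / z)"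
    by (rule telescope_sums'[OF F2[of 0]])
  obtain C where C: "C \<ge> 0" and bd: "\<And>(x::real) (y::real) (s::real). x \<ge> 1 \<Longrightarrow> y \<ge> 1 \<Longrightarrow> s\<^sup>2 = 1 \<Longrightarrow>
       norm (Ln ((x + 1) * z + s * (y + 1)) - Ln (x * z + s * (y + 1)) - Ln ((x + 1) * z + s * y)
         + Ln (x * z + s * y) + s * z / (x * z + s * y)\<^sup>2) \<le> C / (x + y) ^ 3"
    by (rule Ln_mixed_difference_bound[OF z]) blast
  define h where "h m n = f m n - G m n" for m n
  have h: "norm (h m n) \<le> (2 * C / norm z * real (Suc m) powr (- 3 / 2)) * real (Suc n) powr (- 3 / 2)"
    for m n
  proof -
    define x y where "x = real (Suc m)" and "y = real (Suc n)"
    have x: "x \<ge> 1" and y: "y \<ge> 1" by (auto simp: x_def y_def)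
    define P where "P s = Ln ((x + 1) * z + of_real s * (y + 1)) - Ln (x * z + of_real s * (y + 1))
      - Ln ((x + 1) * z + of_real s * y) + Ln (x * z + of_real s * y)
      + of_real s * z / (x * z + of_real s * y)\<^sup>2" for s :: real
    have "norm (P 1) \<le> C / (x + y) ^ 3" "norm (P (-1)) \<le> C / (x + y) ^ 3"
      unfolding P_def using bd[OF x y, of 1] bd[OF x y, of "- 1"] by simp_all
    then have "norm (P 1 - P (-1)) \<le> 2 * C / (x + y) ^ 3"
      using norm_triangle_ineq4[of "P 1" "P (-1)"] by simp
    \<comment> \<open>The signs 1 and -1 give the two logarithms of \<open>Ln_quotient\<close>
      together with the two inverse squares.\<close>
    moreover have "h m n = (P 1 - P (-1)) / z"
      using z0 unfolding h_def f_def G_def F_def Ln_quotient_def P_def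
      by (simp add: x_def y_def field_simps)
    ultimately have "norm (h m n) \<le> (2 * C / (x + y) ^ 3) / norm z"
      by (simp only: norm_divide divide_right_mono norm_ge_zero)
    then have 1: "norm (h m n) \<le> 2 * C / norm z * (1 / (x + y) ^ 3)"
      by (simp add: mult.commute)
    \<comment> \<open>Sharing the exponent 3 equally between the variables leaves 3/2 > 1 for each,
      so both factors are summable.\<close>
    have 2: "1 / (x + y) ^ 3 \<le> x powr (- 3 / 2) * y powr (- 3 / 2)"
    proof -
      have "x powr (3 / 2) * y powr (3 / 2) \<le> (x + y) powr (3 / 2) * (x + y) powr (3 / 2)"
        using x y by (intro mult_mono powr_mono2) auto
      also have "\<dots> = (x + y) ^ 3"
        using x y by (simp flip: powr_add)
      finally have "1 / (x + y) ^ 3 \<le> 1 / (x powr (3 / 2) * y powr (3 / 2))"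
        using x y by (intro divide_left_mono) auto
      then show ?thesis
        using powr_minus_divide[of x "3 / 2"] powr_minus_divide[of y "3 / 2"] by simp
    qed
    show ?thesis
      using order_trans[OF 1 mult_left_mono[OF 2]] C by (simp add: x_def y_def mult.assoc)
  qed
  note D = dominated_double_series[OF summable_mult[OF summable_Suc_powr] _ summable_Suc_powr _ h]
  have D: "summable (h m)" "summable (\<lambda>m. h m n)"
    "summable (\<lambda>m. \<Sum>n. h m n)" "summable (\<lambda>n. \<Sum>m. h m n)"
    "(\<Sum>m. \<Sum>n. h m n) = (\<Sum>n. \<Sum>m. h m n)" for m n
    using D C by auto
  have f: "f m n = h m n + G m n" for m n by (simp add: h_def)
  have f1: "(\<Sum>n. f m n) = (\<Sum>n. h m n) + (F m 0 - F (Suc m) 0)" for m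
    unfolding f by (rule sums_unique[symmetric, OF sums_add[OF summable_sums[OF D(1)] G1]])
  have f2: "(\<Sum>m. f m n) = (\<Sum>m. h m n) + (F 0 n - F 0 (Suc n))" for n
    unfolding f by (rule sums_unique[symmetric, OF sums_add[OF summable_sums[OF D(2)] G2]])
  show ?thesis
  proof (rule that)
    show "(\<lambda>m. \<Sum>n. f m n) sums ((\<Sum>m. \<Sum>n. h m n) + F 0 0)"
      unfolding f1 by (rule sums_add[OF summable_sums[OF D(3)] G12])
    show "(\<lambda>n. \<Sum>m. f m n) sums ((\<Sum>m. \<Sum>n. h m n) + F 0 0 - \<i> * pi / z)"
      unfolding f2 D(5) using sums_add[OF summable_sums[OF D(4)] G21] by (simp add: algebra_simps)
  qed
qed

section \<open>Inversion of the argument of E2\<close>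

lemma inverse_squares_sums_complex: "(\<lambda>n. 1 / (of_nat (Suc n))\<^sup>2 :: complex) sums (pi\<^sup>2 / 6)"
  using sums_of_real[OF inverse_squares_sums, where 'a = complex] by (simp add: add.commute)

text \<open>Partial fractions evaluate the inner sums over \<open>n\<close> at the points
  \<open>m z\<close> and those over \<open>m\<close> at the points \<open>- n / z\<close>. The outer
  sums then give \<open>E2 z\<close> and \<open>E2 (- 1 / z)\<close>, and
  \<open>lattice_sum_swap\<close> compares them.\<close>

theorem E2_minus_inverse:
  fixes z :: complex
  assumes z: "Im z > 0"
  shows "E2 (- 1 / z) = z\<^sup>2 * E2 z - 6 * \<i> * z / pi"
proof -
  have z0: "z \<noteq> 0" using z by auto
  define w where "w = - 1 / z"
  have w: "Im w > 0" using z by (simp add: w_def Im_divide sum_power2_gt_zero_iff)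
  define f where "f = (\<lambda>m n. 1 / (of_nat (Suc m) * z + of_nat (Suc n))\<^sup>2 +
                       1 / (of_nat (Suc m) * z - of_nat (Suc n))\<^sup>2)"
  obtain s where s: "(\<lambda>m. \<Sum>n. f m n) sums s" "(\<lambda>n. \<Sum>m. f m n) sums (s - \<i> * pi / z)"
    using lattice_sum_swap[OF z] unfolding f_def by blast
  have "(\<Sum>n. f m n) = (pi / sin (pi * (of_nat (Suc m) * z)))\<^sup>2 - 1 / z\<^sup>2 * (1 / (of_nat (Suc m))\<^sup>2)" for m
    using sums_unique[OF inverse_sin_squared_sums[OF sin_pi_of_nat_mult_nonzero(1)[OF z, of m]]]
    by (simp add: f_def power_mult_distrib mult.commute del: of_nat_Suc)
  then have "(\<lambda>m. \<Sum>n. f m n) sums (pi\<^sup>2 / 6 * (E2 z - 1) - 1 / z\<^sup>2 * (pi\<^sup>2 / 6))"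
    using sums_diff[OF E2_sin_series[OF z] sums_mult[OF inverse_squares_sums_complex, of "1 / z\<^sup>2"]]
    by presburger
  then have s1: "s = pi\<^sup>2 / 6 * (E2 z - 1) - 1 / z\<^sup>2 * (pi\<^sup>2 / 6)"
    using s(1) sums_unique2 by blast
  have "(\<Sum>m. f m n) = 1 / z\<^sup>2 * (pi / sin (pi * (of_nat (Suc n) * w)))\<^sup>2 - 1 / (of_nat (Suc n))\<^sup>2" for n
  proof -
    let ?N = "of_nat (Suc n) :: complex"
    have N: "?N \<noteq> 0" by (simp del: of_nat_Suc)
    \<comment> \<open>Extracting \<open>z^2\<close> exchanges the roles of the two indices, with
      \<open>w = - 1 / z\<close> in place of \<open>z\<close>.\<close>
    have "f m n = 1 / z\<^sup>2 * (1 / (?N * w + of_nat (Suc m))\<^sup>2 + 1 / (?N * w - of_nat (Suc m))\<^sup>2)" for m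
    proof -
      have "z * (?N * w + of_nat (Suc m)) = of_nat (Suc m) * z - ?N"
        "z * (?N * w - of_nat (Suc m)) = - (of_nat (Suc m) * z + ?N)"
        using z0 by (simp_all add: w_def field_simps del: of_nat_Suc)
      then have "(of_nat (Suc m) * z - ?N)\<^sup>2 = z\<^sup>2 * (?N * w + of_nat (Suc m))\<^sup>2"
        "(of_nat (Suc m) * z + ?N)\<^sup>2 = z\<^sup>2 * (?N * w - of_nat (Suc m))\<^sup>2"
        by (metis power_mult_distrib, metis power_mult_distrib power2_minus)
      then show ?thesis by (simp add: f_def distrib_left del: of_nat_Suc)
    qed
    then have "(\<lambda>m. f m n) sums (1 / z\<^sup>2 * ((pi / sin (pi * (?N * w)))\<^sup>2 - 1 / (?N * w)\<^sup>2))"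
      using sums_mult[OF inverse_sin_squared_sums[OF sin_pi_of_nat_mult_nonzero(1)[OF w, of n]], of "1 / z\<^sup>2"]
      by presburger
    moreover have "1 / z\<^sup>2 * (1 / (?N * w)\<^sup>2) = 1 / ?N\<^sup>2"
      using z0 by (simp add: w_def power_divide power_mult_distrib del: of_nat_Suc)
    ultimately show ?thesis by (simp add: right_diff_distrib sums_iff del: of_nat_Suc)
  qed
  then have "(\<lambda>n. \<Sum>m. f m n) sums (1 / z\<^sup>2 * (pi\<^sup>2 / 6 * (E2 w - 1)) - pi\<^sup>2 / 6)"
    using sums_diff[OF sums_mult[OF E2_sin_series[OF w], of "1 / z\<^sup>2"] inverse_squares_sums_complex]
    by presburger
  then have "1 / z\<^sup>2 * (pi\<^sup>2 / 6 * (E2 w - 1)) - pi\<^sup>2 / 6 = s - \<i> * pi / z"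
    using s(2) sums_unique2 by blast
  then have H: "1 / z\<^sup>2 * (of_real pi ^ 2 / 6 * (E2 w - 1)) - of_real pi ^ 2 / 6 =
      of_real pi ^ 2 / 6 * (E2 z - 1) - 1 / z\<^sup>2 * (of_real pi ^ 2 / 6) - \<i> * pi / z"
    unfolding s1 by simp
  \<comment> \<open>Writing the discrepancy as a multiple of pi^2 / 6 allows this factor to be
    cancelled throughout.\<close>
  have "of_real pi ^ 2 / 6 * (6 * \<i> / (z * pi)) = \<i> * pi / z"
    using z0 by (simp add: divide_simps power2_eq_square)
  then have "of_real pi ^ 2 / 6 * (E2 z - 1 - 1 / z\<^sup>2 - 6 * \<i> / (z * pi)) =
      of_real pi ^ 2 / 6 * (E2 z - 1) - 1 / z\<^sup>2 * (of_real pi ^ 2 / 6) - \<i> * pi / z"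
    by (simp only: right_diff_distrib[of "of_real pi ^ 2 / 6"] mult.commute[of "1 / z\<^sup>2"])
  moreover have "of_real pi ^ 2 / 6 * ((E2 w - 1) / z\<^sup>2 - 1) =
      1 / z\<^sup>2 * (of_real pi ^ 2 / 6 * (E2 w - 1)) - of_real pi ^ 2 / 6"
    by (simp only: right_diff_distrib[of "of_real pi ^ 2 / 6"]) (simp add: diff_divide_distrib right_diff_distrib mult.commute)
  ultimately have eq: "of_real pi ^ 2 / 6 * ((E2 w - 1) / z\<^sup>2 - 1) =
      of_real pi ^ 2 / 6 * (E2 z - 1 - 1 / z\<^sup>2 - 6 * \<i> / (z * pi))"
    using H by (simp only:)
  have "(E2 w - 1) / z\<^sup>2 - 1 = E2 z - 1 - 1 / z\<^sup>2 - 6 * \<i> / (z * pi)"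
    by (rule mult_left_cancel[THEN iffD1, OF _ eq]) simp
  then have "z\<^sup>2 * ((E2 w - 1) / z\<^sup>2 - 1) = z\<^sup>2 * (E2 z - 1 - 1 / z\<^sup>2 - 6 * \<i> / (z * pi))"
    by simp
  moreover have "z\<^sup>2 * ((E2 w - 1) / z\<^sup>2 - 1) = E2 w - 1 - z\<^sup>2"
    using z0 by (simp add: field_simps)
  moreover have "z\<^sup>2 * (E2 z - 1 - 1 / z\<^sup>2 - 6 * \<i> / (z * pi)) =
      z\<^sup>2 * E2 z - z\<^sup>2 - 1 - 6 * \<i> * z / pi"
    using z0 by (simp add: right_diff_distrib power2_eq_square)
  ultimately have "E2 w - 1 - z\<^sup>2 = z\<^sup>2 * E2 z - z\<^sup>2 - 1 - 6 * \<i> * z / pi"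
    by (simp only:)
  then show ?thesis by (simp add: w_def algebra_simps)
qed

section \<open>The action of the modular group\<close>

lemma E2_add_int: "E2 (z + of_int k) = E2 z"
proof -
  have "exp (2 * of_real pi * \<i> * (z + of_int k)) =
      exp (2 * of_real pi * \<i> * z) * exp ((2 * of_int k * pi) * \<i>)"
    by (simp add: algebra_simps flip: exp_add)
  also have "exp ((2 * of_int k * pi) * \<i>) = 1"
    using exp_integer_2pi[of "of_int k"] by simp
  finally show ?thesis by (simp add: E2_def)
qed

lemma moebius_denominator_nonzero:
  fixes c d :: int
  assumes "a * d - b * c = 1" "Im z > 0"
  shows "of_int c * z + of_int d \<noteq> 0"
proof
  assume 0: "of_int c * z + of_int d = 0"
  then have "Im (of_int c * z + of_int d) = 0" "Re (of_int c * z + of_int d) = 0" by simp_all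
  then have "c = 0" "d = 0" using assms(2) by auto
  then show False using assms(1) by simp
qed

lemma Im_moebius:
  fixes a b c d :: int
  assumes "a * d - b * c = 1"
  shows "Im ((of_int a * z + of_int b) / (of_int c * z + of_int d)) =
           Im z / (norm (of_int c * z + of_int d))\<^sup>2"
proof -
  have "real_of_int a * of_int d - of_int b * of_int c = 1"
    using assms by (metis of_int_1 of_int_diff of_int_mult)
  then have "of_int a * Im z * (of_int c * Re z + of_int d) - (of_int a * Re z + of_int b) * (of_int c * Im z) = Im z"
    by algebra
  then show ?thesis by (simp add: Im_divide cmod_power2)
qed

text \<open>Euclidean algorithm on the first column: division of \<open>a\<close> by
  \<open>c\<close> writes the matrix as a translation by \<open>k\<close>, then the inversion, then
  a matrix with the smaller lower left entry \<open>- r\<close>.\<close>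

theorem E2_moebius:
  fixes a b c d :: int
  assumes "a * d - b * c = 1" "Im z > 0"
  shows "E2 ((of_int a * z + of_int b) / (of_int c * z + of_int d)) =
     (of_int c * z + of_int d)\<^sup>2 * E2 z - 6 * \<i> * of_int c * (of_int c * z + of_int d) / pi"
  using assms(1)
proof (induction "nat \<bar>c\<bar>" arbitrary: a b c d rule: less_induct)
  case less
  show ?case
  proof (cases "c = 0")
    case True
    then have "a * d = 1" using less.prems by simp
    then have "a = 1 \<and> d = 1 \<or> a = - 1 \<and> d = - 1" by (metis zmult_eq_1_iff)
    then show ?thesis
      using E2_add_int[of z b] E2_add_int[of z "- b"] True by auto
  next
    case False
    define k r where "k = a div c" and "r = a mod c"
    define b' where "b' = b - k * d"
    have a: "a = k * c + r" by (simp add: k_def r_def)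
    have det: "r * d - b' * c = 1"
      using less.prems by (simp add: a b'_def algebra_simps)
    then have det': "c * (- b') - d * (- r) = 1" by (simp add: algebra_simps)
    have "\<bar>r\<bar> < \<bar>c\<bar>" using False by (simp add: r_def abs_mod_less)
    then have "nat \<bar>- r\<bar> < nat \<bar>c\<bar>" by simp
    note IH = less.hyps[OF this det']
    define e j where "e = of_int c * z + of_int d" and "j = of_int (- r) * z + of_int (- b')"
    have ej: "e \<noteq> 0" "j \<noteq> 0"
      using moebius_denominator_nonzero[OF det assms(2)] moebius_denominator_nonzero[OF det' assms(2)]
      by (auto simp: e_def j_def)
    have "Im (e / j) > 0"
      using Im_moebius[OF det', of z] assms(2) ej by (simp add: e_def j_def)
    have detc: "of_int r * of_int d - of_int b' * of_int c = (1::complex)"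
      using det by (metis of_int_1 of_int_diff of_int_mult)
    \<comment> \<open>By the determinant, the correction terms of the inversion and of the induction
      hypothesis merge into one.\<close>
    have rel: "of_int r * e - 1 = - (of_int c * j)"
      using detc by (simp add: e_def j_def algebra_simps)
    have "(of_int a * z + of_int b) / e = - 1 / (e / j) + of_int k"
      using ej by (simp add: field_simps) (simp add: a b'_def e_def j_def algebra_simps)
    then have "E2 ((of_int a * z + of_int b) / e) = E2 (- 1 / (e / j))"
      by (simp only: E2_add_int)
    also have "\<dots> = (e / j)\<^sup>2 * E2 (e / j) - 6 * \<i> * (e / j) / pi"
      by (rule E2_minus_inverse) fact
    also have "E2 (e / j) = j\<^sup>2 * E2 z - 6 * \<i> * of_int (- r) * j / pi"
      using IH by (simp add: e_def j_def)
    also have "(e / j)\<^sup>2 * (j\<^sup>2 * E2 z - 6 * \<i> * of_int (- r) * j / pi) - 6 * \<i> * (e / j) / pi =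
        e\<^sup>2 * E2 z + 6 * \<i> / pi * (e / j) * (of_int r * e - 1)"
      using ej by (simp add: divide_simps) (simp add: algebra_simps power2_eq_square)
    also have "\<dots> = e\<^sup>2 * E2 z - 6 * \<i> * of_int c * e / pi"
      unfolding rel using ej by (simp add: divide_simps)
    finally show ?thesis by (simp add: e_def)
  qed
qed

section \<open>Ford discs and the equation for the zeros\<close>

text \<open>The disc touches the real axis at \<open>a / c\<close>; after squaring,
  \<open>r^2\<close> cancels and only \<open>2 * r * Im \<tau>\<close> is left.\<close>

lemma ford_disc_iff:
  assumes "c \<noteq> 0"
  shows "\<tau> \<in> ford_disc a c \<longleftrightarrow>
    (of_int c)\<^sup>2 * (norm (\<tau> - of_int a / of_int c))\<^sup>2 < Im \<tau>"
proof -
  define r where "r = 1 / (2 * (real_of_int c)\<^sup>2)"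
  have r: "r > 0" "(real_of_int c)\<^sup>2 = 1 / (2 * r)" using assms by (auto simp: r_def)
  have "\<tau> \<in> ford_disc a c \<longleftrightarrow> norm (\<tau> - Complex (of_int a / of_int c) r) < r"
    by (simp add: ford_disc_def r_def dist_norm norm_minus_commute)
  also have "\<dots> \<longleftrightarrow> (norm (\<tau> - Complex (of_int a / of_int c) r))\<^sup>2 < r\<^sup>2"
    using r by (metis less_imp_le norm_ge_zero power_less_imp_less_base power_strict_mono zero_less_numeral)
  also have "\<dots> \<longleftrightarrow> (norm (\<tau> - of_int a / of_int c))\<^sup>2 < 2 * r * Im \<tau>"
  proof -
    have "of_int a / of_int c = complex_of_real (of_int a / of_int c)" by simp
    then have "Re (of_int a / of_int c) = of_int a / of_int c" "Im (of_int a / of_int c) = 0"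
      by (metis Re_complex_of_real, metis Im_complex_of_real)
    then show ?thesis
      unfolding cmod_power2 by (simp add: power2_eq_square algebra_simps)
  qed
  also have "\<dots> \<longleftrightarrow> (of_int c)\<^sup>2 * (norm (\<tau> - of_int a / of_int c))\<^sup>2 < Im \<tau>"
    unfolding r(2) using r(1) by (simp add: field_simps)
  finally show ?thesis .
qed

text \<open>With e = c z + d, the image differs from \<open>a / c\<close> by
  \<open>- 1 / (c e)\<close> and has imaginary part \<open>Im z / |e|^2\<close>, so
  \<open>|e|\<close> drops out of the criterion.\<close>

lemma moebius_in_ford_disc_iff:
  fixes a b c d :: int
  assumes det: "a * d - b * c = 1" and z: "Im z > 0" and c: "c \<noteq> 0"
  shows "(of_int a * z + of_int b) / (of_int c * z + of_int d) \<in> ford_disc a c \<longleftrightarrow> Im z > 1"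
proof -
  define e where "e = of_int c * z + of_int d"
  have e: "e \<noteq> 0" using moebius_denominator_nonzero[OF det z] by (simp add: e_def)
  have detc: "of_int a * of_int d - of_int b * of_int c = (1::complex)"
    using det by (metis of_int_1 of_int_diff of_int_mult)
  have "(of_int a * z + of_int b) / e - of_int a / of_int c = - 1 / (of_int c * e)"
    using e c detc by (simp add: divide_simps) (simp add: e_def algebra_simps)
  moreover have "Im ((of_int a * z + of_int b) / e) = Im z / (norm e)\<^sup>2"
    using Im_moebius[OF det] by (simp add: e_def)
  ultimately show ?thesis
    unfolding ford_disc_iff[OF c] e_def[symmetric]
    using e c by (simp add: norm_divide norm_mult power_divide power_mult_distrib divide_simps)
qed

text \<open>The transformation law has the nonzero factor \<open>e = c z + d\<close>; setting the
  other factor to zero and solving for \<open>z\<close> gives the equation.\<close>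

lemma E2_moebius_eq_0_iff:
  fixes a b c d :: int
  assumes det: "a * d - b * c = 1" and z: "Im z > 0" and c: "c \<noteq> 0" and E: "E2 z \<noteq> 0"
  shows "E2 ((of_int a * z + of_int b) / (of_int c * z + of_int d)) = 0 \<longleftrightarrow>
    z = - (of_int d / of_int c) + of_real (6 / pi) * \<i> / E2 z"
proof -
  define e where "e = of_int c * z + of_int d"
  have e: "e \<noteq> 0" using moebius_denominator_nonzero[OF det z] by (simp add: e_def)
  have "E2 ((of_int a * z + of_int b) / e) = e * (e * E2 z - 6 * \<i> * of_int c / pi)"
    using E2_moebius[OF det z] by (simp add: e_def power2_eq_square algebra_simps)
  then have "E2 ((of_int a * z + of_int b) / e) = 0 \<longleftrightarrow> e * E2 z = 6 * \<i> * of_int c / pi"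
    using e by simp
  also have "\<dots> \<longleftrightarrow> e = of_int c * (of_real (6 / pi) * \<i> / E2 z)"
    using E by (auto simp: field_simps)
  also have "\<dots> \<longleftrightarrow> z = - (of_int d / of_int c) + of_real (6 / pi) * \<i> / E2 z"
    using c by (auto simp: e_def field_simps)
  finally show ?thesis by (simp add: e_def)
qed

section \<open>Estimates for large imaginary part\<close>

lemma norm_power_Suc_diff_le:
  fixes p q :: complex
  assumes "norm p \<le> r" "norm q \<le> r"
  shows "norm (q ^ Suc n - p ^ Suc n) \<le> of_nat (Suc n) * r ^ n * norm (q - p)"
proof (induction n)
  case (Suc n)
  have r: "r \<ge> 0" using assms norm_ge_zero order_trans by blast
  have "q ^ Suc (Suc n) - p ^ Suc (Suc n) = q * (q ^ Suc n - p ^ Suc n) + p ^ Suc n * (q - p)"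
    by (simp add: algebra_simps)
  also have "norm \<dots> \<le> norm q * norm (q ^ Suc n - p ^ Suc n) + norm p ^ Suc n * norm (q - p)"
    by (metis norm_mult norm_power norm_triangle_ineq)
  also have "\<dots> \<le> r * (of_nat (Suc n) * r ^ n * norm (q - p)) + r ^ Suc n * norm (q - p)"
    using assms r Suc.IH by (intro add_mono mult_mono power_mono) auto
  also have "\<dots> = of_nat (Suc (Suc n)) * r ^ Suc n * norm (q - p)"
    by (simp add: algebra_simps)
  finally show ?case .
qed simp

text \<open>Replaces the polynomial coefficients of the Lambert estimates by geometric ones, of
  ratio \<open>4 * r\<close>.\<close>

lemma Suc_square_le: "(real (Suc n))\<^sup>2 \<le> 4 ^ n"
proof (induction n)
  case (Suc n)
  have "real (Suc (Suc n)) \<le> 2 * real (Suc n)" by simp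
  then have "(real (Suc (Suc n)))\<^sup>2 \<le> (2 * real (Suc n))\<^sup>2" by (intro power_mono) auto
  also have "\<dots> = 4 * (real (Suc n))\<^sup>2" by (simp only: power_mult_distrib) simp
  finally show ?case using Suc.IH by simp
qed simp

text \<open>The difference of two values of x / (1 - x) has numerator x - y and, here, denominators
  of modulus at least 499/500; 101/100 exceeds (500/499)^2.\<close>

lemma lambert_term_diff_le:
  fixes p q :: complex
  assumes p: "norm p \<le> r" and q: "norm q \<le> r" and r: "r \<le> 1 / 500"
  shows "norm (of_nat (Suc n) * q ^ Suc n / (1 - q ^ Suc n) - of_nat (Suc n) * p ^ Suc n / (1 - p ^ Suc n))
    \<le> 101 / 100 * norm (q - p) * (4 * r) ^ n"
proof -
  have r0: "r \<ge> 0" using p norm_ge_zero order_trans by blast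
  have low: "499 / 500 \<le> norm (1 - x ^ Suc n)" if "norm x \<le> r" for x :: complex
  proof -
    have "norm (x ^ Suc n) \<le> norm x * 1"
      using that r by (simp add: norm_mult norm_power mult_left_le power_le_one)
    then have "norm (x ^ Suc n) \<le> 1 / 500" using that r by linarith
    then show ?thesis using norm_triangle_ineq2[of 1 "x ^ Suc n"] by simp
  qed
  have nz: "1 - q ^ Suc n \<noteq> 0" "1 - p ^ Suc n \<noteq> 0" using low[OF p] low[OF q] by auto
  have "of_nat (Suc n) * q ^ Suc n / (1 - q ^ Suc n) - of_nat (Suc n) * p ^ Suc n / (1 - p ^ Suc n) =
      of_nat (Suc n) * (q ^ Suc n - p ^ Suc n) / ((1 - q ^ Suc n) * (1 - p ^ Suc n))"
    using nz by (simp add: diff_frac_eq del: of_nat_Suc power_Suc) (simp add: algebra_simps)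
  also have "norm \<dots> = real (Suc n) * norm (q ^ Suc n - p ^ Suc n) /
      (norm (1 - q ^ Suc n) * norm (1 - p ^ Suc n))"
    by (simp only: norm_divide norm_mult norm_of_nat)
  also have "\<dots> \<le> real (Suc n) * (of_nat (Suc n) * r ^ n * norm (q - p)) / (499 / 500 * (499 / 500))"
    using low[OF p] low[OF q] norm_power_Suc_diff_le[OF p q, of n] r0
    by (intro frac_le mult_mono) auto
  also have "\<dots> = (500 / 499)\<^sup>2 * norm (q - p) * ((real (Suc n))\<^sup>2 * r ^ n)"
    by (simp add: power2_eq_square)
  also have "\<dots> \<le> 101 / 100 * norm (q - p) * (4 ^ n * r ^ n)"
    using Suc_square_le[of n] r0 by (intro mult_mono) (auto simp: power2_eq_square)
  finally show ?thesis by (simp add: power_mult_distrib)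
qed

lemma summable_lambert:
  assumes "norm q \<le> 1 / 500"
  shows "summable (\<lambda>n. of_nat (Suc n) * q ^ Suc n / (1 - q ^ Suc n) :: complex)"
proof (rule summable_comparison_test'[where N = 0])
  show "summable (\<lambda>n. 101 / 100 * norm (q - 0) * (4 * norm q) ^ n)"
    using assms by (intro summable_mult summable_geometric) auto
  show "norm (of_nat (Suc n) * q ^ Suc n / (1 - q ^ Suc n) :: complex)
      \<le> 101 / 100 * norm (q - 0) * (4 * norm q) ^ n" for n
    using lambert_term_diff_le[of 0 "norm q" q n] assms by simp
qed

lemma lambert_lipschitz:
  assumes p: "norm p \<le> 1 / 500" and q: "norm q \<le> 1 / 500"
  shows "norm (lambert q - lambert p) \<le> 102 / 100 * norm (q - p)"
proof -
  let ?t = "\<lambda>q n. of_nat (Suc n) * q ^ Suc n / (1 - q ^ Suc n) :: complex"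
  let ?b = "\<lambda>n::nat. 101 / 100 * norm (q - p) * (4 * (1 / 500)) ^ n :: real"
  have b: "?b sums (101 / 100 * norm (q - p) * (1 / (1 - 4 * (1 / 500))))"
    by (intro sums_mult geometric_sums) simp
  have "lambert q - lambert p = (\<Sum>n. ?t q n - ?t p n)"
    unfolding lambert_def by (rule suminf_diff[OF summable_lambert[OF q] summable_lambert[OF p]])
  also have "norm \<dots> \<le> (\<Sum>n. ?b n)"
    by (rule norm_suminf_le[OF lambert_term_diff_le[OF p q order_refl] sums_summable[OF b]])
  also have "\<dots> \<le> 102 / 100 * norm (q - p)"
    unfolding sums_unique[OF b, symmetric] by simp
  finally show ?thesis .
qed

text \<open>The first term differs from \<open>q\<close> by q^2 / (1 - q), and the tail is geometric
  starting at order |q|^2; each contributes at most 5 |q|^2.\<close>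

lemma lambert_approx:
  assumes q: "norm q \<le> 1 / 500"
  shows "norm (lambert q - q) \<le> 10 * (norm q)\<^sup>2"
proof -
  let ?t = "\<lambda>n. of_nat (Suc n) * q ^ Suc n / (1 - q ^ Suc n) :: complex"
  let ?b = "\<lambda>n::nat. 101 / 100 * norm q * (4 * norm q) * (4 * norm q) ^ n :: real"
  have b: "?b sums (101 / 100 * norm q * (4 * norm q) * (1 / (1 - 4 * norm q)))"
    using q by (intro sums_mult geometric_sums) simp
  have "norm (?t (Suc n)) \<le> ?b n" for n
  proof -
    have "norm (?t (Suc n)) \<le> 101 / 100 * norm q * (4 * norm q) ^ Suc n"
      using lambert_term_diff_le[of 0 "norm q" q "Suc n"] q by simp
    then show ?thesis by (simp only: power_Suc mult.assoc)
  qed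
  then have "norm (\<Sum>n. ?t (Suc n)) \<le> (\<Sum>n. ?b n)"
    by (rule norm_suminf_le[OF _ sums_summable[OF b]])
  also have "\<dots> = 101 / 100 * norm q * (4 * norm q) * (1 / (1 - 4 * norm q))"
    by (rule sums_unique[OF b, symmetric])
  also have "\<dots> \<le> 101 / 100 * norm q * (4 * norm q) * (1 / (1 - 4 * (1 / 500)))"
    using q by (intro mult_left_mono frac_le) auto
  also have "\<dots> \<le> 5 * (norm q)\<^sup>2"
    by (simp add: power2_eq_square)
  finally have 1: "norm (\<Sum>n. ?t (Suc n)) \<le> 5 * (norm q)\<^sup>2" .
  have low: "499 / 500 \<le> norm (1 - q)" using norm_triangle_ineq2[of 1 q] q by simp
  then have nz: "1 - q \<noteq> 0" by auto
  have "?t 0 - q = q\<^sup>2 / (1 - q)"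
    using nz by (simp add: field_simps power2_eq_square)
  then have "norm (?t 0 - q) = (norm q)\<^sup>2 / norm (1 - q)"
    by (simp add: norm_divide norm_power)
  also have "\<dots> \<le> (norm q)\<^sup>2 / (499 / 500)" using low by (intro divide_left_mono) auto
  also have "\<dots> \<le> 5 * (norm q)\<^sup>2" by simp
  finally have 2: "norm (?t 0 - q) \<le> 5 * (norm q)\<^sup>2" .
  have "lambert q - q = (\<Sum>n. ?t (Suc n)) + (?t 0 - q)"
    unfolding lambert_def using suminf_split_head[OF summable_lambert[OF q]] by simp
  then have "norm (lambert q - q) \<le> norm (\<Sum>n. ?t (Suc n)) + norm (?t 0 - q)"
    by (metis norm_triangle_ineq)
  then show ?thesis using 1 2 by linarith
qed

lemma lambert_norm_le:
  assumes "norm q \<le> 1 / 500"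
  shows "norm (lambert q) \<le> 102 / 100 * norm q"
  using lambert_lipschitz[of 0 q] assms by (simp add: lambert_def)

section \<open>Size of the nome and of E2 on the half plane Im z >= 1\<close>

lemma norm_exp_2pi: "norm (exp (2 * of_real pi * \<i> * z)) = exp (- (2 * pi * Im z))"
  by (simp add: norm_exp_eq_Re)

lemma exp_1_bounds: "271828 / 100000 \<le> exp (1 :: real)" "exp (1 :: real) \<le> 271829 / 100000"
proof -
  have "\<bar>exp 1 - 5837465777 / 2147483648\<bar> \<le> (1 / 10 ^ 9 :: real)"
    by (rule order_trans[OF e_approx_32]) simp
  then show "271828 / 100000 \<le> exp (1 :: real)" "exp (1 :: real) \<le> 271829 / 100000"
    by (simp_all only: abs_le_iff) (simp_all add: field_simps)
qed

lemma exp_minus_2pi_le: "exp (- (2 * pi)) \<le> 1 / (500 :: real)"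
proof -
  \<comment> \<open>The exponent 6.28, slightly below 2 pi, is split as 6 + 0.28.\<close>
  have "(500 :: real) \<le> (271 / 100) ^ 6 * (1 + 28 / 100)" by (simp add: power_divide)
  also have "\<dots> \<le> exp 1 ^ 6 * exp (28 / 100)"
    using exp_1_bounds by (intro mult_mono power_mono exp_ge_add_one_self) auto
  also have "\<dots> = exp (628 / 100)"
    by (simp flip: exp_of_nat_mult exp_add)
  also have "\<dots> \<le> exp (2 * pi)" using pi_approx by simp
  finally show ?thesis by (simp add: exp_minus field_simps)
qed

lemma norm_nome_le:
  assumes "Im z \<ge> 1"
  shows "norm (exp (2 * of_real pi * \<i> * z)) \<le> 1 / 500"
proof -
  have "exp (- (2 * pi * Im z)) \<le> exp (- (2 * pi))" using assms by simp
  then show ?thesis unfolding norm_exp_2pi using exp_minus_2pi_le by linarith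
qed

lemma nome_lipschitz:
  assumes "Im z \<ge> 1" "Im w \<ge> 1"
  shows "norm (exp (2 * of_real pi * \<i> * z) - exp (2 * of_real pi * \<i> * w)) \<le> 2 * pi / 500 * norm (z - w)"
proof (rule field_differentiable_bound[of "{z. Im z \<ge> 1}"])
  show "convex {z. Im z \<ge> 1}" by (rule convex_halfspace_Im_ge)
  fix x assume x: "x \<in> {z. Im z \<ge> 1}"
  show "((\<lambda>z. exp (2 * of_real pi * \<i> * z)) has_field_derivative
      exp (2 * of_real pi * \<i> * x) * (2 * of_real pi * \<i>)) (at x within {z. Im z \<ge> 1})"
    by (auto intro!: derivative_eq_intros)
  show "norm (exp (2 * of_real pi * \<i> * x) * (2 * of_real pi * \<i>)) \<le> 2 * pi / 500"
    using norm_nome_le[of x] x pi_gt_zero unfolding norm_mult by (simp add: field_simps)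
qed (use assms in auto)

lemma E2_near_1:
  assumes "Im z \<ge> 1"
  shows "norm (E2 z - 1) \<le> 5 / 100" "norm (E2 z) \<ge> 95 / 100"
proof -
  show 1: "norm (E2 z - 1) \<le> 5 / 100"
    using lambert_norm_le[OF norm_nome_le[OF assms]] norm_nome_le[OF assms]
    by (simp add: E2_lambert norm_mult)
  show "norm (E2 z) \<ge> 95 / 100"
    using norm_triangle_ineq2[of 1 "1 - E2 z"] 1 by (simp add: norm_minus_commute)
qed

text \<open>The Lipschitz constants multiply: 24 from \<open>E2\<close>, 1.02 from
  \<open>lambert\<close> and 2 pi / 500 from the nome, in total below 0.31.\<close>

lemma E2_lipschitz:
  assumes "Im z \<ge> 1" "Im w \<ge> 1"
  shows "norm (E2 z - E2 w) \<le> 31 / 100 * norm (z - w)"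
proof -
  define Q where "Q = (\<lambda>z. exp (2 * of_real pi * \<i> * z))"
  have "norm (E2 z - E2 w) = 24 * norm (lambert (Q z) - lambert (Q w))"
  proof -
    have "E2 z - E2 w = 24 * (lambert (Q w) - lambert (Q z))"
      by (simp add: E2_lambert Q_def algebra_simps)
    then have "norm (E2 z - E2 w) = 24 * norm (lambert (Q w) - lambert (Q z))"
      by (simp only: norm_mult norm_numeral)
    then show ?thesis by (simp only: norm_minus_commute)
  qed
  also have "\<dots> \<le> 24 * (102 / 100 * norm (Q z - Q w))"
    unfolding Q_def using assms by (intro mult_left_mono lambert_lipschitz norm_nome_le) auto
  also have "\<dots> \<le> 24 * (102 / 100 * (2 * pi / 500 * norm (z - w)))"
    unfolding Q_def using assms by (intro mult_left_mono nome_lipschitz) auto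
  also have "\<dots> = (24 * 102 / 100 * 2 / 500 * pi) * norm (z - w)" by simp
  also have "\<dots> \<le> 31 / 100 * norm (z - w)"
    using pi_approx by (intro mult_right_mono) auto
  finally show ?thesis .
qed

text \<open>The fixed points of this map with \<open>u = - d / c\<close> are the preimages of the zeros of \<open>E2\<close>.\<close>

definition zero_map :: "complex \<Rightarrow> complex \<Rightarrow> complex" where
  "zero_map u z = u + of_real (6 / pi) * \<i> / E2 z"

lemma six_over_pi: "6 / pi \<ge> 190 / 100" "6 / pi \<le> 191 / 100"
  using pi_approx pi_gt_zero by (auto simp: field_simps)

text \<open>As \<open>1 / E2 z\<close> lies within 5/95 of 1, its real part is at least 90/95, and
  1.9 * 90/95 = 1.8.\<close>

lemma zero_map_Im_gt:
  assumes u: "Im u = 0" and z: "Im z \<ge> 1"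
  shows "Im (zero_map u z) > 1"
proof -
  have nz: "E2 z \<noteq> 0" using E2_near_1(2)[OF z] by auto
  have "norm (1 / E2 z - 1) = norm (E2 z - 1) / norm (E2 z)"
  proof -
    have "1 / E2 z - 1 = (1 - E2 z) / E2 z" using nz by (simp add: diff_divide_distrib)
    then show ?thesis by (simp only: norm_divide norm_minus_commute)
  qed
  also have "\<dots> \<le> (5 / 100) / (95 / 100)"
    using E2_near_1[OF z] by (intro frac_le) auto
  finally have "norm (1 / E2 z - 1) \<le> 5 / 95" by simp
  then have "\<bar>Re (1 / E2 z - 1)\<bar> \<le> 5 / 95"
    using abs_Re_le_cmod[of "1 / E2 z - 1"] by linarith
  then have R: "Re (1 / E2 z) \<ge> 90 / 95"
    unfolding minus_complex.sel one_complex.sel by linarith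
  have "zero_map u z = u + of_real (6 / pi) * (\<i> * (1 / E2 z))" by (simp add: zero_map_def)
  then have "Im (zero_map u z) = Im u + Im (of_real (6 / pi) * (\<i> * (1 / E2 z)))"
    by (simp only: plus_complex.sel)
  also have "\<dots> = 6 / pi * Re (1 / E2 z)"
  proof -
    have "Im (of_real r * (\<i> * v)) = r * Re v" for r v by simp
    then show ?thesis by (simp only: u add_0)
  qed
  also have "\<dots> \<ge> 190 / 100 * (90 / 95)"
    using R six_over_pi by (intro mult_mono) auto
  finally show ?thesis by simp
qed

lemma zero_map_contraction:
  assumes "Im z \<ge> 1" "Im w \<ge> 1"
  shows "norm (zero_map u z - zero_map u w) \<le> 7 / 10 * norm (z - w)"
proof -
  have nz: "E2 z \<noteq> 0" "E2 w \<noteq> 0" using E2_near_1(2) assms by force+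
  have "zero_map u z - zero_map u w = of_real (6 / pi) * \<i> * ((E2 w - E2 z) / (E2 z * E2 w))"
    using nz by (simp add: zero_map_def field_simps)
  then have "norm (zero_map u z - zero_map u w) =
      6 / pi * (norm (E2 z - E2 w) / (norm (E2 z) * norm (E2 w)))"
    by (simp add: norm_mult norm_divide norm_minus_commute)
  also have "\<dots> \<le> 191 / 100 * ((31 / 100 * norm (z - w)) / (95 / 100 * (95 / 100)))"
    using six_over_pi E2_near_1(2)[OF assms(1)] E2_near_1(2)[OF assms(2)] E2_lipschitz[OF assms]
    by (intro mult_mono[OF six_over_pi(2)] frac_le mult_mono) auto
  also have "\<dots> \<le> 7 / 10 * norm (z - w)" by simp
  finally show ?thesis .
qed

text \<open>Banach's theorem is applied on the closed, hence complete, half plane; the map sends it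
  into the open one, so the fixed point satisfies the strict inequality.\<close>

lemma zero_map_unique_fixpoint:
  assumes u: "Im u = 0"
  shows "\<exists>!z. Im z > 1 \<and> zero_map u z = z"
proof -
  have "\<exists>!z. z \<in> {z. Im z \<ge> 1} \<and> zero_map u z = z"
  proof (rule Banach_fix[where c = "7 / 10"])
    show "complete {z. Im z \<ge> 1}"
      by (simp add: complete_eq_closed closed_halfspace_Im_ge)
    show "{z. Im z \<ge> 1} \<noteq> {}" by (auto intro: exI[of _ \<i>])
    show "zero_map u ` {z. Im z \<ge> 1} \<subseteq> {z. Im z \<ge> 1}"
      using zero_map_Im_gt[OF u] by force
  qed (use zero_map_contraction in \<open>auto simp: dist_norm\<close>)
  then show ?thesis
    using zero_map_Im_gt[OF u] by (metis less_imp_le mem_Collect_eq)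
qed

lemma exp_minus_12: "exp (- 12 :: real) \<ge> 614 / 10 ^ 8" "exp (- 12 :: real) \<le> 615 / 10 ^ 8"
proof -
  have e: "exp (12 :: real) = exp 1 ^ 12" by (simp flip: exp_of_nat_mult)
  have "(271828 / 100000) ^ 12 \<le> exp (12 :: real)" "exp (12 :: real) \<le> (271829 / 100000) ^ 12"
    unfolding e using exp_1_bounds by (intro power_mono; simp)+
  then have "10 ^ 8 / 615 \<le> exp (12 :: real)" "exp (12 :: real) \<le> 10 ^ 8 / 614"
    by (simp_all add: power_divide)
  then show "exp (- 12 :: real) \<ge> 614 / 10 ^ 8" "exp (- 12 :: real) \<le> 615 / 10 ^ 8"
    by (simp_all add: exp_minus field_simps)
qed

text \<open>Bootstrapping: a bound on the distance \<open>\<delta>\<close> confines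
  \<open>Im z\<close>, which confines |q|, which improves the bound on \<open>\<delta>\<close>.
  Three rounds reach the required precision.\<close>

lemma zero_map_fixpoint_bounds:
  assumes u: "Im u = 0" and z: "Im z > 1" and fix_z: "zero_map u z = z"
  shows "0.00027 < norm (z - (u + of_real (6 / pi) * \<i>))"
    and "norm (z - (u + of_real (6 / pi) * \<i>)) < 0.00029"
proof -
  define q where "q = exp (2 * of_real pi * \<i> * z)"
  define \<delta> where "\<delta> = norm (z - (u + of_real (6 / pi) * \<i>))"
  define l where "l = norm (lambert q)"
  have q: "norm q \<le> 1 / 500" unfolding q_def using z by (intro norm_nome_le) simp
  have E: "E2 z = 1 - 24 * lambert q" by (simp add: E2_lambert q_def)
  have nz: "E2 z \<noteq> 0" using E2_near_1(2)[of z] z by auto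
  have "z - (u + of_real (6 / pi) * \<i>) = of_real (6 / pi) * \<i> * ((1 - E2 z) / E2 z)"
  proof -
    define \<kappa> where "\<kappa> = complex_of_real (6 / pi) * \<i>"
    have "z - u = \<kappa> / E2 z"
      using fix_z by (metis \<kappa>_def add_diff_cancel_left' zero_map_def)
    then have "z - (u + \<kappa>) = \<kappa> / E2 z - \<kappa>" by (simp add: algebra_simps)
    also have "\<dots> = \<kappa> * ((1 - E2 z) / E2 z)" using nz by (simp add: field_simps)
    finally show ?thesis by (simp only: \<kappa>_def)
  qed
  then have \<delta>: "\<delta> = 6 / pi * (24 * l / norm (E2 z))"
    by (simp add: \<delta>_def l_def norm_mult norm_divide E)
  have El: "norm (E2 z) \<ge> 1 - 24 * l" "norm (E2 z) \<le> 1 + 24 * l"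
    using norm_triangle_ineq2[of 1 "24 * lambert q"] norm_triangle_ineq4[of 1 "24 * lambert q"]
    by (simp_all add: E l_def norm_mult)
  have l: "l \<le> 102 / 100 * norm q" unfolding l_def by (rule lambert_norm_le[OF q])
  have l': "l \<ge> norm q - 10 * (norm q)\<^sup>2"
    using lambert_approx[OF q] norm_triangle_ineq2[of q "q - lambert q"]
    by (simp add: l_def norm_minus_commute)
  have l'': "l \<le> norm q + 10 * (norm q)\<^sup>2"
    using lambert_approx[OF q] norm_triangle_ineq2[of "lambert q" q] by (simp add: l_def)
  have l0: "l \<ge> 0" by (simp add: l_def)
  have upper: "\<delta> \<le> 191 / 100 * (24 * L / (1 - 24 * L))" if "l \<le> L" "L \<le> 1 / 100" for L
    unfolding \<delta> using El that l0 by (intro mult_mono[OF six_over_pi(2)] frac_le) auto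
  have "\<bar>Im (z - (u + of_real (6 / pi) * \<i>))\<bar> \<le> \<delta>"
    unfolding \<delta>_def by (rule abs_Im_le_cmod)
  then have Im: "\<bar>Im z - 6 / pi\<bar> \<le> \<delta>" using u by simp
  \<comment> \<open>Here 12 is 2 pi times the expected height 6 / pi.\<close>
  have "exp (- (2 * pi * Im z)) = exp (- 12 - 2 * pi * (Im z - 6 / pi))"
    by (simp add: field_simps)
  then have nq: "norm q = exp (- 12) * exp (- (2 * pi * (Im z - 6 / pi)))"
    unfolding q_def norm_exp_2pi by (simp flip: exp_add)
  have expo: "\<bar>2 * pi * (Im z - 6 / pi)\<bar> \<le> 63 / 10 * D" if "\<delta> \<le> D" for D
  proof -
    have "2 * pi * \<bar>Im z - 6 / pi\<bar> \<le> 63 / 10 * D"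
      using that Im pi_approx by (intro mult_mono) auto
    then show ?thesis by (simp add: abs_mult)
  qed
  \<comment> \<open>First round: only |q| <= 1/500 is available, so \<open>l\<close> is at most 1.02
    / 500.\<close>
  have "\<delta> \<le> 191 / 100 * (24 * (204 / 100000) / (1 - 24 * (204 / 100000)))"
    using l q by (intro upper) auto
  then have "\<delta> \<le> 1 / 10" by simp
  \<comment> \<open>Second round: |q| exceeds exp(-12) by a factor of at most e.\<close>
  then have "- (2 * pi * (Im z - 6 / pi)) \<le> 1" using expo[of "1 / 10"] by simp
  then have "exp (- (2 * pi * (Im z - 6 / pi))) \<le> exp 1" by simp
  then have "exp (- (2 * pi * (Im z - 6 / pi))) \<le> 272 / 100" using e_less_272 by linarith
  then have "norm q \<le> 615 / 10 ^ 8 * (272 / 100)"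
    unfolding nq using exp_minus_12 by (intro mult_mono) auto
  then have "l \<le> 171 / 10 ^ 7" using l by simp
  then have "\<delta> \<le> 191 / 100 * (24 * (171 / 10 ^ 7) / (1 - 24 * (171 / 10 ^ 7)))"
    by (intro upper) auto
  then have "\<delta> \<le> 8 / 10 ^ 4" by simp
  then have t: "\<bar>2 * pi * (Im z - 6 / pi)\<bar> \<le> 504 / 10 ^ 5" using expo[of "8 / 10 ^ 4"] by simp
  define t where "t = 2 * pi * (Im z - 6 / pi)"
  have t: "\<bar>t\<bar> \<le> 504 / 10 ^ 5" using t by (simp add: t_def)
  \<comment> \<open>Third round: the inequality 1 + x <= exp x, at -t and at t, encloses |q| from
    both sides.\<close>
  have "exp (- t) \<ge> 1 - 504 / 10 ^ 5"
    using exp_ge_add_one_self[of "- t"] t by linarith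
  then have "norm q \<ge> 614 / 10 ^ 8 * (1 - 504 / 10 ^ 5)"
    unfolding nq t_def[symmetric] using exp_minus_12 by (intro mult_mono) auto
  then have q1: "norm q \<ge> 610 / 10 ^ 8" by simp
  have "exp t \<ge> 1 - 504 / 10 ^ 5"
    using exp_ge_add_one_self[of t] t by linarith
  then have "exp (- t) \<le> 1 / (1 - 504 / 10 ^ 5)"
    by (simp add: exp_minus field_simps)
  then have "norm q \<le> 615 / 10 ^ 8 * (1 / (1 - 504 / 10 ^ 5))"
    unfolding nq t_def[symmetric] using exp_minus_12 by (intro mult_mono) auto
  then have q2: "norm q \<le> 619 / 10 ^ 8" by simp
  have q3: "(norm q)\<^sup>2 \<le> (619 / 10 ^ 8)\<^sup>2" using q2 by (intro power_mono) auto
  have "l \<le> 620 / 10 ^ 8" using l'' q2 q3 by (simp add: power_divide)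
  note up = upper[OF this]
  have l_lo: "l \<ge> 609 / 10 ^ 8" using l' q1 q3 by (simp add: power_divide)
  show "norm (z - (u + of_real (6 / pi) * \<i>)) < 0.00029"
    using up unfolding \<delta>_def by simp
  have "190 / 100 * (24 * (609 / 10 ^ 8) / (1 + 24 * (620 / 10 ^ 8))) \<le> \<delta>"
    unfolding \<delta> using El l_lo \<open>l \<le> 620 / 10 ^ 8\<close> nz
    by (intro mult_mono[OF six_over_pi(1)] frac_le) auto
  then show "0.00027 < norm (z - (u + of_real (6 / pi) * \<i>))"
    unfolding \<delta>_def by simp
qed

section \<open>Zeros in Ford discs\<close>

lemma mat22_in_SL2Z_iff: "mat22 a b c d \<in> SL2Z \<longleftrightarrow> a * d - b * c = 1"
  by (simp add: SL2Z_def det_2)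

lemma moebius_act_mat22:
  "moebius_act (mat22 a b c d) z = (of_int a * z + of_int b) / (of_int c * z + of_int d)"
  by (simp add: moebius_act_def)

lemma moebius_zero_in_ford_disc_iff:
  assumes "a * d - b * c = 1" "Im z > 0" "c > 0"
  shows "moebius_act (mat22 a b c d) z \<in> ford_disc a c \<and> E2 (moebius_act (mat22 a b c d) z) = 0 \<longleftrightarrow>
    Im z > 1 \<and> zero_map (- (of_int d / of_int c)) z = z"
proof -
  have "E2 z \<noteq> 0" if "Im z > 1" using E2_near_1(2)[of z] that by auto
  then show ?thesis
    using moebius_in_ford_disc_iff[OF assms(1,2)] E2_moebius_eq_0_iff[OF assms(1,2)] assms(3)
    by (auto simp: moebius_act_mat22 zero_map_def)
qed

text \<open>The witness is the image of \<open>\<tau>\<close> under the inverse matrix; its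
  denominator \<open>j\<close> is the reciprocal of \<open>c z + d\<close>.\<close>

lemma moebius_act_surj:
  assumes det: "a * d - b * c = 1" and \<tau>: "Im \<tau> > 0"
  obtains z where "Im z > 0" "moebius_act (mat22 a b c d) z = \<tau>"
proof
  define z where "z = (of_int d * \<tau> + of_int (- b)) / (of_int (- c) * \<tau> + of_int a)"
  have det': "d * a - (- b) * (- c) = 1" using det by (simp add: mult.commute)
  have nz: "of_int (- c) * \<tau> + of_int a \<noteq> 0"
    by (rule moebius_denominator_nonzero[OF det' \<tau>])
  show z: "Im z > 0" unfolding z_def Im_moebius[OF det'] using \<tau> nz by simp
  define j where "j = of_int (- c) * \<tau> + of_int a"
  have detc: "of_int a * of_int d - of_int b * of_int c = (1::complex)"
    using det by (metis of_int_1 of_int_diff of_int_mult)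
  have jz: "j * z = of_int d * \<tau> - of_int b" using nz by (simp add: z_def j_def)
  have "j * (of_int a * z + of_int b) = of_int a * (j * z) + j * of_int b"
    by (simp add: algebra_simps)
  also have "\<dots> = (of_int a * of_int d - of_int b * of_int c) * \<tau>"
    unfolding jz by (simp add: j_def algebra_simps)
  finally have num: "j * (of_int a * z + of_int b) = \<tau>" using detc by simp
  have "j * (of_int c * z + of_int d) = of_int c * (j * z) + j * of_int d"
    by (simp add: algebra_simps)
  also have "\<dots> = of_int a * of_int d - of_int b * of_int c"
    unfolding jz by (simp add: j_def algebra_simps)
  finally have den: "j * (of_int c * z + of_int d) = 1" using detc by simp
  have "(of_int a * z + of_int b) / (of_int c * z + of_int d) =
      (j * (of_int a * z + of_int b)) / (j * (of_int c * z + of_int d))"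
    using nz by (simp add: j_def)
  then show "moebius_act (mat22 a b c d) z = \<tau>"
    by (simp add: moebius_act_mat22 num den)
qed

text \<open>Rounding the real part moves it into [-1/2, 1/2), while Im > 1 already forces the
  modulus above 1.\<close>

lemma fund_dom_translate:
  assumes "Im z > 1"
  obtains k :: int where "z - of_int k \<in> fund_dom"
proof
  define k where "k = \<lfloor>Re z + 1 / 2\<rfloor>"
  define w where "w = z - of_int k"
  have "Re w \<ge> - 1 / 2" "Re w < 1 / 2" unfolding w_def k_def by simp_all linarith+
  moreover have "Im w > 1" using assms by (simp add: w_def)
  moreover have "norm w > 1" using abs_Im_le_cmod[of w] \<open>Im w > 1\<close> by linarith
  ultimately show "z - of_int k \<in> fund_dom"
    unfolding w_def[symmetric] by (auto simp: fund_dom_def upper_half_plane_def)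
qed

theorem theorem1p2:
  fixes a c :: int
  assumes "coprime a c" and "c > 0"
  shows "(\<exists>!\<tau>. \<tau> \<in> ford_disc a c \<and> E2 \<tau> = 0) \<and>
    (\<forall>\<tau>. \<tau> \<in> ford_disc a c \<and> E2 \<tau> = 0 \<longrightarrow>
      (\<exists>b d z. mat22 a b c d \<in> SL2Z \<and> z \<in> fund_dom \<and> \<tau> = moebius_act (mat22 a b c d) z) \<and>
      (\<forall>b d z. mat22 a b c d \<in> SL2Z \<and> z \<in> fund_dom \<and> \<tau> = moebius_act (mat22 a b c d) z \<longrightarrow>
        0.00027 < norm (z - (- (of_int d / of_int c) + of_real (6 / pi) * \<i>)) \<and>
        norm (z - (- (of_int d / of_int c) + of_real (6 / pi) * \<i>)) < 0.00029))"
proof -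
  have real: "Im (- (of_int d / of_int c :: complex)) = 0" for d
    by (simp add: Im_divide)
  obtain b d where det: "a * d - b * c = 1"
  proof -
    obtain u v where "u * a + v * c = gcd a c" using bezout_int by blast
    then show thesis using that[of u "- v"] assms(1) by (simp add: algebra_simps)
  qed
  define M where "M = moebius_act (mat22 a b c d)"
  have lift: "\<exists>z. Im z > 0 \<and> M z = \<tau>" if "\<tau> \<in> ford_disc a c" for \<tau>
  proof -
    have "0 \<le> (real_of_int c)\<^sup>2 * (norm (\<tau> - of_int a / of_int c))\<^sup>2" by simp
    then have "Im \<tau> > 0" using that ford_disc_iff[of c \<tau> a] assms(2) by linarith
    then show ?thesis using moebius_act_surj[OF det] unfolding M_def by metis
  qed
  have iff: "M z \<in> ford_disc a c \<and> E2 (M z) = 0 \<longleftrightarrow>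
      Im z > 1 \<and> zero_map (- (of_int d / of_int c)) z = z" if "Im z > 0" for z
    unfolding M_def by (rule moebius_zero_in_ford_disc_iff[OF det that assms(2)])
  \<comment> \<open>By \<open>lift\<close> and \<open>iff\<close>, the zeros in the disc are exactly
    the images under \<open>M\<close> of the fixed points with Im > 1, of which there is
    one.\<close>
  have "\<exists>!\<tau>. \<tau> \<in> ford_disc a c \<and> E2 \<tau> = 0"
  proof -
    obtain z where z: "Im z > 1" "zero_map (- (of_int d / of_int c)) z = z"
      and uniq: "\<And>w. Im w > 1 \<Longrightarrow> zero_map (- (of_int d / of_int c)) w = w \<Longrightarrow> w = z"
      using zero_map_unique_fixpoint[OF real] by metis
    show ?thesis
    proof (rule ex1I[of _ "M z"])
      show "M z \<in> ford_disc a c \<and> E2 (M z) = 0" using iff[of z] z by simp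
      show "\<tau> = M z" if "\<tau> \<in> ford_disc a c \<and> E2 \<tau> = 0" for \<tau>
        using that lift[of \<tau>] iff uniq by metis
    qed
  qed
  moreover have "\<exists>b d z. mat22 a b c d \<in> SL2Z \<and> z \<in> fund_dom \<and> \<tau> = moebius_act (mat22 a b c d) z"
    if \<tau>: "\<tau> \<in> ford_disc a c \<and> E2 \<tau> = 0" for \<tau>
  proof -
    obtain w where w: "Im w > 0" "M w = \<tau>" using lift \<tau> by blast
    then have "Im w > 1" using iff \<tau> by blast
    then obtain k where k: "w - of_int k \<in> fund_dom" by (rule fund_dom_translate)
    \<comment> \<open>Multiplying by a translation on the right keeps the first column, and thus the
      disc, while shifting \<open>w\<close> by \<open>k\<close>.\<close>
    have "mat22 a (b + k * a) c (d + k * c) \<in> SL2Z"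
      using det by (simp add: mat22_in_SL2Z_iff algebra_simps)
    moreover have "\<tau> = moebius_act (mat22 a (b + k * a) c (d + k * c)) (w - of_int k)"
      unfolding w(2)[symmetric] M_def moebius_act_mat22 by (simp add: algebra_simps)
    ultimately show ?thesis using k by blast
  qed
  moreover have "0.00027 < norm (z - (- (of_int d / of_int c) + of_real (6 / pi) * \<i>)) \<and>
        norm (z - (- (of_int d / of_int c) + of_real (6 / pi) * \<i>)) < 0.00029"
    if "\<tau> \<in> ford_disc a c \<and> E2 \<tau> = 0"
      and z: "mat22 a b c d \<in> SL2Z \<and> z \<in> fund_dom \<and> \<tau> = moebius_act (mat22 a b c d) z" for \<tau> b d z
  proof -
    have "Im z > 0" using z by (auto simp: fund_dom_def upper_half_plane_def)
    then have "Im z > 1 \<and> zero_map (- (of_int d / of_int c)) z = z"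
      using that moebius_zero_in_ford_disc_iff[of a d b c z] assms(2) by (simp add: mat22_in_SL2Z_iff)
    then show ?thesis using zero_map_fixpoint_bounds[OF real] by blast
  qed
  ultimately show ?thesis by blast
qed

end
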